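(* Let $H$ be a Hilbert space, $\Gamma$ the covariance operator of the noise $\xi\sim\mathcal{N}(0,\Gamma)$ on $H$, $\mu_0$ a prior on $H$, and consider the posteriors $\mu^{y_n}$ for the regression model $y=a+\frac{1}{\sqrt n}\xi$ with data $y_n=a^\dagger+\frac1{\sqrt n}\xi$. Suppose that there is $\sigma_0\ge0$ such that $\Gamma^\sigma$ is trace-class for all $\sigma>\sigma_0$, and that for some $s>1+\sigma_0$ and some constant $U$ $$\|a\|_s\le U\quad\mu_0\text{-a.s.}$$ If $a^\dagger\in\operatorname{supp}_{\mathcal{H}^1}(\mu_0)$ and $a^\dagger\in\mathcal{H}^s$, then $\mu^{y_n}$ is posterior consistent for $a^\dagger$ in $\mathcal{H}^1$. Additionally, if for some $\rho>0$ the small ball asymptotic $$\log\mu_0\big(B^1_\epsilon(a^\dagger)\big)\gtrsim-\epsilon^{-\rho}$$ is satisfied, then posterior consistency in $\mathcal{H}^1$ holds with rate $n^{-\kappa}$ for any $$\kappa<\min\Big\{\frac{1}{2(2-\lambda)},\frac{1}{2+\rho}\Big\},\qquad \lambda=\frac{s-1-\sigma_0}{s-1}.$$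
   Context: Hilbert scale: $\Gamma$ is a self-adjoint, positive-definite, trace-class operator on $H$ with eigenpairs $(\lambda_k^2,\phi_k)$. For $t\in\mathbb{R}$, $\langle u,v\rangle_t=\langle\Gamma^{-t/2}u,\Gamma^{-t/2}v\rangle$, $\|u\|_t=\|\Gamma^{-t/2}u\|$, and $\mathcal{H}^t$ is the completion of $\bigcap_{n\ge0}\mathcal{D}(\Gamma^{-n})$ under $\|\cdot\|_t$. $B^t_R(u)=\{x:\|u-x\|_t\le R\}$. $\mathcal{H}^1$ is the Cameron–Martin space of $\mathcal{N}(0,\Gamma)$. The trace-class condition reads $\sum_k\lambda_k^{2\sigma}<\infty$ for all $\sigma>\sigma_0$. Posterior: for data $y=a^\dagger+\frac{1}{\sqrt n}\xi$, $$\frac{d\mu^{y}}{d\mu_0}(a)=Z(n,\xi)\exp\Big(-\tfrac n2\|a-a^\dagger\|_1^2+\sqrt n\,\langle a-a^\dagger,\xi\rangle_1\Big),$$ where $Z(n,\xi)$ is the normalising constant and $\langle\cdot,\xi\rangle_1$ is understood as the duality pairing $\langle u,\xi\rangle_1=\sum_k\lambda_k^{-2}u_k\xi_k$ between $\mathcal{H}^{1+\sigma}$ and $\mathcal{H}^{1-\sigma}$, $\sigma>\sigma_0$ (almost surely $\xi\in\mathcal{H}^{1-\sigma}$ for every $\sigma>\sigma_0$). Posterior consistency for $a^\dagger$ in a normed space with rate $\epsilon_n\downarrow0$: there exist a constant $M$ and $l_n\to1$ with $\mathbb{P}_{\xi}\big(\mu^{y_n}(B_{M\epsilon_n}(a^\dagger))\ge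 l_n\big)\to1$, balls taken in the given norm. "Posterior consistent" without a rate means this holds with $\epsilon_n=\epsilon$ for every fixed constant $\epsilon>0$ (i.e. for each radius $\epsilon>0$). Support: $\operatorname{supp}_d(\mu)=\{x:\mu(B^d_\epsilon(x))>0\ \forall\epsilon>0\}$; $\operatorname{supp}_{\mathcal{H}^1}$ uses the metric of $\|\cdot\|_1$. The notation $\log\mu_0(B_\epsilon)\gtrsim-\epsilon^{-\rho}$ means there are $C,\epsilon_0>0$ with $\log\mu_0(B_\epsilon)\ge-C\epsilon^{-\rho}$ for $0<\epsilon\le\epsilon_0$. *)

theory Defs
  imports "HOL-Probability.Probability"
begin

text \<open>
  A self-adjoint, positive-definite, trace-class operator \<open>\<Gamma>\<close> on a real Hilbert space together with
  eigenpairs \<open>((lam k)\<^sup>2, \<phi> k)\<close>, \<open>k \<in> K\<close>, whose eigenvectors form an orthonormal basis.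
  The index set \<open>K \<subseteq> \<nat>\<close> is arbitrary, so the space may be finite- or infinite-dimensional;
  separability follows from the existence of the countable basis.
\<close>

locale covariance_operator =
  fixes \<Gamma> :: "'h::{real_inner, complete_space} \<Rightarrow> 'h"
    and K :: "nat set" and lam :: "nat \<Rightarrow> real" and \<phi> :: "nat \<Rightarrow> 'h"
  assumes bounded_linear: "bounded_linear \<Gamma>"
    and self_adjoint: "\<And>u v. \<Gamma> u \<bullet> v = u \<bullet> \<Gamma> v"
    and positive_definite: "\<And>u. u \<noteq> 0 \<Longrightarrow> 0 < \<Gamma> u \<bullet> u"
    and orthonormal: "\<And>j k. j \<in> K \<Longrightarrow> k \<in> K \<Longrightarrow> \<phi> j \<bullet> \<phi> k = (if j = k then 1 else 0)"
    and complete_basis: "closure (span (\<phi> ` K)) = UNIV"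
    and eigenvalue_pos: "\<And>k. k \<in> K \<Longrightarrow> 0 < lam k"
    and eigenpair: "\<And>k. k \<in> K \<Longrightarrow> \<Gamma> (\<phi> k) = (lam k)\<^sup>2 *\<^sub>R \<phi> k"
    and trace_class: "(\<lambda>k. (lam k)\<^sup>2) summable_on K"

text \<open>
  The power \<open>\<Gamma>\<^sup>r\<close> and its domain, by functional calculus. Outside the domain the value of
  \<open>op_power\<close> is meaningless; hence membership in the relevant space is
  always stated separately wherever a norm of the scale is bounded.
\<close>

definition op_power_dom ::
  "nat set \<Rightarrow> (nat \<Rightarrow> real) \<Rightarrow> (nat \<Rightarrow> 'h::{real_inner, complete_space}) \<Rightarrow> real \<Rightarrow> 'h set" where
  "op_power_dom K lam \<phi> r = {u. (\<lambda>k. (lam k powr (2 * r) * (u \<bullet> \<phi> k))\<^sup>2) summable_on K}"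

definition op_power ::
  "nat set \<Rightarrow> (nat \<Rightarrow> real) \<Rightarrow> (nat \<Rightarrow> 'h::{real_inner, complete_space}) \<Rightarrow> real \<Rightarrow> 'h \<Rightarrow> 'h" where
  "op_power K lam \<phi> r u = (\<Sum>\<^sub>\<infinity>k\<in>K. (lam k powr (2 * r) * (u \<bullet> \<phi> k)) *\<^sub>R \<phi> k)"

definition hs_norm ::
  "nat set \<Rightarrow> (nat \<Rightarrow> real) \<Rightarrow> (nat \<Rightarrow> 'h::{real_inner, complete_space}) \<Rightarrow> real \<Rightarrow> 'h \<Rightarrow> real" where
  "hs_norm K lam \<phi> t u = norm (op_power K lam \<phi> (- t / 2) u)"

text \<open>
  The space \<open>H\<^sup>t\<close> for \<open>t \<ge> 0\<close>: the completion of \<open>\<Inter>n. D(\<Gamma>\<^sup>-\<^sup>n)\<close> under the norm of order \<open>t\<close>,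
  realised inside the ambient space. For \<open>t \<ge> 0\<close> that norm dominates the ambient norm (up to a
  constant) and \<open>\<Gamma>\<close> to the power \<open>-t/2\<close> is closed, so every Cauchy sequence has an ambient limit
  that determines its class. For \<open>t < 0\<close>, which is not needed here, the
  completion is larger than the ambient space and is not described by this definition.
\<close>

definition hs_space ::
  "nat set \<Rightarrow> (nat \<Rightarrow> real) \<Rightarrow> (nat \<Rightarrow> 'h::{real_inner, complete_space}) \<Rightarrow> real \<Rightarrow> 'h set" where
  "hs_space K lam \<phi> t = {u. \<exists>x. (\<forall>i. x i \<in> (\<Inter>n. op_power_dom K lam \<phi> (- real n))) \<and>
     (\<forall>e>0. \<exists>N. \<forall>i\<ge>N. \<forall>j\<ge>N. hs_norm K lam \<phi> t (x i - x j) < e) \<and>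
     x \<longlonglongrightarrow> u}"

definition hs_ball ::
  "nat set \<Rightarrow> (nat \<Rightarrow> real) \<Rightarrow> (nat \<Rightarrow> 'h::{real_inner, complete_space}) \<Rightarrow> real \<Rightarrow> 'h \<Rightarrow> real \<Rightarrow> 'h set" where
  "hs_ball K lam \<phi> t u R = {x. u - x \<in> hs_space K lam \<phi> t \<and> hs_norm K lam \<phi> t (u - x) \<le> R}"

definition hs_support ::
  "nat set \<Rightarrow> (nat \<Rightarrow> real) \<Rightarrow> (nat \<Rightarrow> 'h::{real_inner, complete_space}) \<Rightarrow> real \<Rightarrow> 'h measure \<Rightarrow> 'h set" where
  "hs_support K lam \<phi> t \<mu> =
     {x \<in> hs_space K lam \<phi> t. \<forall>\<epsilon>>0. 0 < emeasure \<mu> (hs_ball K lam \<phi> t x \<epsilon>)}"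

text \<open>The conjunct \<open>0 < measure \<dots>\<close> is needed because \<open>ln 0 = 0\<close> in HOL.\<close>

definition small_ball_bound ::
  "nat set \<Rightarrow> (nat \<Rightarrow> real) \<Rightarrow> (nat \<Rightarrow> 'h::{real_inner, complete_space}) \<Rightarrow> 'h measure \<Rightarrow> 'h \<Rightarrow> real \<Rightarrow> bool" where
  "small_ball_bound K lam \<phi> \<mu>0 a \<rho> \<longleftrightarrow>
     (\<exists>C>0. \<exists>\<epsilon>0>0. \<forall>\<epsilon>. 0 < \<epsilon> \<and> \<epsilon> \<le> \<epsilon>0 \<longrightarrow>
        0 < measure \<mu>0 (hs_ball K lam \<phi> 1 a \<epsilon>) \<and>
        ln (measure \<mu>0 (hs_ball K lam \<phi> 1 a \<epsilon>)) \<ge> - C * \<epsilon> powr (- \<rho>))"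

text \<open>The centred Gaussian measure \<open>N(0, \<Gamma>)\<close>, by its one-dimensional marginals.\<close>

definition centred_gaussian :: "('h::{real_inner, complete_space} \<Rightarrow> 'h) \<Rightarrow> 'h measure \<Rightarrow> bool" where
  "centred_gaussian \<Gamma> \<nu> \<longleftrightarrow> prob_space \<nu> \<and> sets \<nu> = sets borel \<and>
     (\<forall>h. distr \<nu> borel (\<lambda>x. x \<bullet> h) =
        (if \<Gamma> h \<bullet> h = 0 then return borel 0
         else density lborel (\<lambda>z. ennreal (normal_density 0 (sqrt (\<Gamma> h \<bullet> h)) z))))"

text \<open>
  The duality pairing between the spaces of order \<open>1 + \<sigma>\<close> and \<open>1 - \<sigma>\<close>. The noise takes values
  in the ambient space, so both arguments are represented by ambient elements.
\<close>

definition hs_pairing ::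
  "nat set \<Rightarrow> (nat \<Rightarrow> real) \<Rightarrow> (nat \<Rightarrow> 'h::{real_inner, complete_space}) \<Rightarrow> 'h \<Rightarrow> 'h \<Rightarrow> real" where
  "hs_pairing K lam \<phi> u \<xi> = (\<Sum>\<^sub>\<infinity>k\<in>K. lam k powr (- 2) * (u \<bullet> \<phi> k) * (\<xi> \<bullet> \<phi> k))"

definition likelihood ::
  "nat set \<Rightarrow> (nat \<Rightarrow> real) \<Rightarrow> (nat \<Rightarrow> 'h::{real_inner, complete_space}) \<Rightarrow> 'h \<Rightarrow> nat \<Rightarrow> 'h \<Rightarrow> 'h \<Rightarrow> real" where
  "likelihood K lam \<phi> a\<^sub>0 n \<xi> a =
     exp (- (real n / 2) * (hs_norm K lam \<phi> 1 (a - a\<^sub>0))\<^sup>2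
          + sqrt (real n) * hs_pairing K lam \<phi> (a - a\<^sub>0) \<xi>)"

text \<open>
  The posterior for the data \<open>y = a\<^sub>0 + (1 / sqrt n) *\<^sub>R \<xi>\<close>; the normalising constant is the reciprocal
  of the integral of the likelihood against the prior.
\<close>

definition posterior ::
  "nat set \<Rightarrow> (nat \<Rightarrow> real) \<Rightarrow> (nat \<Rightarrow> 'h::{real_inner, complete_space}) \<Rightarrow> 'h measure \<Rightarrow>
     'h \<Rightarrow> nat \<Rightarrow> 'h \<Rightarrow> 'h measure" where
  "posterior K lam \<phi> \<mu>0 a\<^sub>0 n \<xi> =
     density \<mu>0 (\<lambda>a. ennreal (likelihood K lam \<phi> a\<^sub>0 n \<xi> a) /
                     (\<integral>\<^sup>+ b. ennreal (likelihood K lam \<phi> a\<^sub>0 n \<xi> b) \<partial>\<mu>0))"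

text \<open>
  Posterior consistency for a family of random measures \<open>post n \<omega>\<close>; \<open>B r\<close> is the ball of
  radius \<open>r\<close> about the truth in the norm under consideration.
  Consistency without a rate is the statement for every fixed radius; a constant factor in
  front of the radius, if allowed to depend on it, would make the notion much weaker.
\<close>

definition consistent_with_rate ::
  "'w measure \<Rightarrow> (nat \<Rightarrow> 'w \<Rightarrow> 'h measure) \<Rightarrow> (real \<Rightarrow> 'h set) \<Rightarrow> (nat \<Rightarrow> real) \<Rightarrow> bool" where
  "consistent_with_rate P post B \<epsilon> \<longleftrightarrow>
     (\<exists>M>0. \<exists>l :: nat \<Rightarrow> real. l \<longlonglongrightarrow> 1 \<and>
        (\<lambda>n. measure P {\<omega> \<in> space P. measure (post n \<omega>) (B (M * \<epsilon> n)) \<ge> l n}) \<longlonglongrightarrow> 1)"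

definition consistent ::
  "'w measure \<Rightarrow> (nat \<Rightarrow> 'w \<Rightarrow> 'h measure) \<Rightarrow> (real \<Rightarrow> 'h set) \<Rightarrow> bool" where
  "consistent P post B \<longleftrightarrow>
     (\<forall>\<epsilon>>0. \<exists>l :: nat \<Rightarrow> real. l \<longlonglongrightarrow> 1 \<and>
        (\<lambda>n. measure P {\<omega> \<in> space P. measure (post n \<omega>) (B \<epsilon>) \<ge> l n}) \<longlonglongrightarrow> 1)"

end

(* In the coordinates of the eigenbasis the norms of the scale are weighted l^2-norms. Interpolation
   between orders 1 and s, together with the a.s. bound on the order-s norm, bounds the noise term
   of the log-likelihood at a by sqrt n * X * r^theta up to a constant, where r is the order-1
   distance from a to the truth and X the order-(1 - sigma) norm of the noise. As X has a finite
   second moment (the trace of Gamma^sigma), with high probability half of the quadratic term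
   n r^2 / 2 absorbs the noise term as soon as r >= delta_n, provided that
   sqrt n * delta_n^(2 - theta) tends to infinity. The likelihood is then at most
   exp (- n delta_n^2) outside the ball of radius 2 delta_n and at least exp (- 3/4 n delta_n^2) on
   the ball of radius delta_n, so the posterior mass of the complement is at most
   exp (- n delta_n^2 / 4) divided by the prior mass of the small ball. *)

theory Submission
  imports Defs
begin

text \<open>In infinite dimension the noise almost surely has infinite norm of order 1, so
  Cauchy-Schwarz in order 1 cannot control the pairing. The regularity missing from the noise is
  taken from \<open>a - a\<^sub>0\<close> at order 1 + \<sigma>, and \<theta> is the weight with 1 +
  \<sigma> = \<theta> * 1 + (1 - \<theta>) * s. The trace of order \<sigma> is only known to be
  finite for \<sigma> > \<sigma>0, so \<theta> stays below \<lambda> and tends to it as \<sigma>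
  decreases to \<sigma>0; the strict bound on \<kappa> leaves room for this gap. For \<delta> n = n
  powr (- k) the noise condition reads k * (2 - \<theta>) < 1/2, and n * (\<delta> n)^2 dominates
  the small-ball cost (\<delta> n) powr (- \<rho>) when k * (2 + \<rho>) < 1. These are the two
  entries of the minimum, the first with \<theta> in place of \<lambda>. A divergent sum has the
  value 0, so a bound on \<open>hs_norm\<close> alone carries no information; summability of
  \<open>coeff_sq\<close> accompanies it throughout.\<close>

section \<open>Infinite sums\<close>

text \<open>A finite set that nearly exhausts the sum lies below some N. Any finite set beyond N is
  disjoint from it, and by nonnegativity the two together stay below the total.\<close>

lemma summable_nonneg_tail:
  fixes d :: "nat \<Rightarrow> real"
  assumes "d summable_on K" "\<And>k. k \<in> K \<Longrightarrow> 0 \<le> d k" "0 < e"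
  obtains N where "\<And>F. finite F \<Longrightarrow> F \<subseteq> K - {..<N} \<Longrightarrow> sum d F < e"
proof -
  obtain F0 where F0: "finite F0" "F0 \<subseteq> K" "dist (sum d F0) (infsum d K) \<le> e/2"
    using infsum_finite_approximation[OF assms(1), of "e/2"] assms(3) by auto
  obtain N where N: "F0 \<subseteq> {..<N}"
    using finite_nat_iff_bounded F0(1) by blast
  have "sum d F < e" if F: "finite F" "F \<subseteq> K - {..<N}" for F
  proof -
    have "sum d (F0 \<union> F) \<le> infsum d K"
      using F F0 assms by (intro finite_sum_le_infsum) auto
    moreover have "sum d (F0 \<union> F) = sum d F0 + sum d F"
      using F F0 N by (intro sum.union_disjoint) auto
    ultimately show ?thesis using F0(3) assms(3) by (simp add: dist_real_def abs_if split: if_splits)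
  qed
  then show ?thesis using that by blast
qed

text \<open>Completeness yields limits of sequences, whereas \<open>has_sum\<close> is convergence
  over all finite subsets. Control of every finite set beyond N, not only of intervals, bridges the
  two. Orthogonal series need this because they may fail to converge absolutely.\<close>

lemma has_sum_nat_tail:
  fixes f :: "nat \<Rightarrow> 'a::real_normed_vector"
  assumes lim: "(\<lambda>N. \<Sum>k\<in>K \<inter> {..<N}. f k) \<longlonglongrightarrow> L"
    and tail: "\<And>e. 0 < e \<Longrightarrow> \<exists>N. \<forall>F. finite F \<and> F \<subseteq> K - {..<N} \<longrightarrow> norm (sum f F) < e"
  shows "(f has_sum L) K"
  unfolding has_sum_def tendsto_iff eventually_finite_subsets_at_top
proof (intro allI impI)
  fix e :: real assume "e > 0"
  obtain N where N: "\<And>F. finite F \<Longrightarrow> F \<subseteq> K - {..<N} \<Longrightarrow> norm (sum f F) < e/2"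
    using tail[of "e/2"] \<open>e > 0\<close> by auto
  obtain M where M: "\<And>n. n \<ge> M \<Longrightarrow> dist (\<Sum>k\<in>K \<inter> {..<n}. f k) L < e/2"
    using metric_LIMSEQ_D[OF lim, of "e/2"] \<open>e > 0\<close> by auto
  define n where "n = max N M"
  show "\<exists>X. finite X \<and> X \<subseteq> K \<and>
      (\<forall>Y. finite Y \<and> X \<subseteq> Y \<and> Y \<subseteq> K \<longrightarrow> dist (sum f Y) L < e)"
  proof (intro exI[of _ "K \<inter> {..<n}"] conjI allI impI)
    fix Y assume Y: "finite Y \<and> K \<inter> {..<n} \<subseteq> Y \<and> Y \<subseteq> K"
    have "sum f Y = sum f (K \<inter> {..<n}) + sum f (Y - K \<inter> {..<n})"
      using Y by (metis add.commute sum.subset_diff)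
    moreover have "norm (sum f (Y - K \<inter> {..<n})) < e/2"
      using Y by (intro N) (auto simp: n_def)
    moreover have "dist (sum f (K \<inter> {..<n})) L < e/2" by (intro M) (simp add: n_def)
    ultimately show "dist (sum f Y) L < e"
      using norm_triangle_ineq[of "sum f (K \<inter> {..<n}) - L" "sum f (Y - K \<inter> {..<n})"]
      by (simp add: dist_norm algebra_simps)
  qed auto
qed

text \<open>For reals, unconditional and absolute convergence agree. Reading sums as integrals makes
  parametric measurability and Tonelli's theorem available for them.\<close>

lemma integrable_count_space_iff_summable_on:
  fixes f :: "'a \<Rightarrow> real"
  shows "integrable (count_space A) f \<longleftrightarrow> f summable_on A"
  using summable_on_iff_abs_summable_on_real abs_summable_equivalent
  by (metis Infinite_Set_Sum.abs_summable_on_def)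

text \<open>Both sides are \<open>0\<close> when the series diverges.\<close>

lemma infsum_eq_integral_count_space:
  fixes f :: "'a \<Rightarrow> real"
  shows "infsum f A = (\<integral>k. f k \<partial>count_space A)"
proof (cases "f summable_on A")
  case True
  then have "Infinite_Set_Sum.abs_summable_on f A"
    using summable_on_iff_abs_summable_on_real abs_summable_equivalent by blast
  then show ?thesis using infsetsum_infsum by (metis infsetsum_def)
next
  case False
  then show ?thesis
    by (simp add: infsum_not_exists not_integrable_integral_eq integrable_count_space_iff_summable_on)
qed

lemma measurable_pair_count_space:
  fixes f :: "'a \<Rightarrow> 'i::countable \<Rightarrow> 'b"
  assumes "\<And>k. k \<in> A \<Longrightarrow> (\<lambda>x. f x k) \<in> measurable M N"
  shows "(\<lambda>(x, k). f x k) \<in> measurable (M \<Otimes>\<^sub>M count_space A) N"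
  unfolding case_prod_beta
  by (intro measurable_compose_countable'[where f = "\<lambda>k z. f (fst z) k" and g = snd and I = A]
      measurable_compose[OF measurable_fst] assms) auto

lemma borel_measurable_infsum_real:
  fixes f :: "'a \<Rightarrow> nat \<Rightarrow> real"
  assumes "\<And>k. k \<in> A \<Longrightarrow> (\<lambda>x. f x k) \<in> borel_measurable M"
  shows "(\<lambda>x. infsum (f x) A) \<in> borel_measurable M"
proof -
  interpret sigma_finite_measure "count_space A"
    by (rule sigma_finite_measure_count_space_countable) simp
  have "(\<lambda>(x, k). f x k) \<in> borel_measurable (M \<Otimes>\<^sub>M count_space A)"
    by (intro measurable_pair_count_space assms)
  then show ?thesis
    unfolding infsum_eq_integral_count_space by (rule borel_measurable_lebesgue_integral)
qed

text \<open>Membership in a space of the scale is summability of a coordinate series, so this is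
  what makes the balls Borel sets.\<close>

lemma pred_summable_on_real:
  fixes f :: "'a \<Rightarrow> nat \<Rightarrow> real"
  assumes [measurable]: "\<And>k. k \<in> A \<Longrightarrow> (\<lambda>x. f x k) \<in> borel_measurable M"
  shows "Measurable.pred M (\<lambda>x. f x summable_on A)"
proof -
  interpret sigma_finite_measure "count_space A"
    by (rule sigma_finite_measure_count_space_countable) simp
  have "(\<lambda>(x, k). f x k) \<in> borel_measurable (M \<Otimes>\<^sub>M count_space A)"
    by (intro measurable_pair_count_space assms)
  then have "Measurable.pred M (\<lambda>x. integrable (count_space A) (f x))"
    by measurable
  then show ?thesis by (simp add: integrable_count_space_iff_summable_on)
qed

text \<open>The form with weights a + b = 1 serves twice: a = b = 1/2 gives Cauchy-Schwarz for the
  pairing, a = \<theta> the interpolation inequality. After normalising both sums it is Young's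
  inequality term by term.\<close>

lemma Hoelder_infsum:
  fixes x y :: "'a \<Rightarrow> real"
  assumes x: "x summable_on A" "\<And>k. k \<in> A \<Longrightarrow> 0 \<le> x k"
    and y: "y summable_on A" "\<And>k. k \<in> A \<Longrightarrow> 0 \<le> y k"
    and ab: "0 < a" "0 < b" "a + b = 1"
  shows "(\<lambda>k. x k powr a * y k powr b) summable_on A"
    and "(\<Sum>\<^sub>\<infinity>k\<in>A. x k powr a * y k powr b) \<le> infsum x A powr a * infsum y A powr b"
proof -
  define X Y where "X = infsum x A" and "Y = infsum y A"
  have XY: "0 \<le> X" "0 \<le> Y" unfolding X_def Y_def using x y by (auto intro: infsum_nonneg)
  have young: "u powr a * v powr b \<le> a * u + b * v" if "0 \<le> u" "0 \<le> v" for u v :: real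
    using that ab Youngs_inequality_0[of a b u v] by (cases "u = 0 \<or> v = 0") auto
  have sab: "(\<lambda>k. a * x k + b * y k) summable_on A"
    by (intro summable_on_add summable_on_cmult_right x y)
  show s: "(\<lambda>k. x k powr a * y k powr b) summable_on A"
    by (rule summable_on_comparison_test[OF sab]) (use x y young in auto)
  show "(\<Sum>\<^sub>\<infinity>k\<in>A. x k powr a * y k powr b) \<le> infsum x A powr a * infsum y A powr b"
  proof (cases "X = 0 \<or> Y = 0")
    case True
    then have "\<forall>k\<in>A. x k powr a * y k powr b = 0"
      using nonneg_infsum_le_0D[of x A] nonneg_infsum_le_0D[of y A] x y
      by (force simp: X_def Y_def)
    then show ?thesis using infsum_0[of A "\<lambda>k. x k powr a * y k powr b"] by simp
  next
    case False
    then have pos: "X > 0" "Y > 0" using XY by auto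
    \<comment> \<open>Young's inequality is applied to \<open>x k / X\<close> and
      \<open>y k / Y\<close>, whose sums are 1; the factor c undoes this scaling.\<close>
    define c where "c = X powr a * Y powr b"
    have c: "c > 0" using pos by (simp add: c_def)
    have le: "x k powr a * y k powr b \<le> (c * a / X) * x k + (c * b / Y) * y k" if "k \<in> A" for k
    proof -
      have "(x k / X) powr a * (y k / Y) powr b \<le> a * (x k / X) + b * (y k / Y)"
        using that x y pos by (intro young) auto
      then have "c * ((x k / X) powr a * (y k / Y) powr b) \<le> c * (a * (x k / X) + b * (y k / Y))"
        using c by simp
      moreover have "c * ((x k / X) powr a * (y k / Y) powr b) = x k powr a * y k powr b"
        using that x y pos by (simp add: c_def powr_divide)
      ultimately show ?thesis by (simp add: algebra_simps)
    qed
    have s1: "(\<lambda>k. (c * a / X) * x k) summable_on A" "(\<lambda>k. (c * b / Y) * y k) summable_on A"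
      by (intro summable_on_cmult_right x y)+
    have "(\<Sum>\<^sub>\<infinity>k\<in>A. x k powr a * y k powr b)
        \<le> (\<Sum>\<^sub>\<infinity>k\<in>A. (c * a / X) * x k + (c * b / Y) * y k)"
      by (intro infsum_mono s le summable_on_add s1)
    also have "\<dots> = (c * a / X) * X + (c * b / Y) * Y"
      by (subst infsum_add[OF s1]) (simp only: infsum_cmult_right' X_def Y_def)
    also have "\<dots> = c * (a + b)" using pos by (simp add: algebra_simps)
    finally show ?thesis using ab by (simp add: c_def X_def Y_def)
  qed
qed

section \<open>The Hilbert scale in coordinates\<close>

context covariance_operator
begin

section \<open>Orthonormal series and Parseval's identity\<close>

lemma inner_sum_basis:
  assumes "finite F" "F \<subseteq> K" "j \<in> K"
  shows "(\<Sum>k\<in>F. c k *\<^sub>R \<phi> k) \<bullet> \<phi> j = (if j \<in> F then c j else 0)"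
proof -
  have "(\<Sum>k\<in>F. c k *\<^sub>R \<phi> k) \<bullet> \<phi> j = (\<Sum>k\<in>F. if j = k then c k else 0)"
    unfolding inner_sum_left using assms by (intro sum.cong) (auto simp: orthonormal)
  then show ?thesis using assms by simp
qed

lemma norm_sum_basis:
  assumes "finite F" "F \<subseteq> K"
  shows "(norm (\<Sum>k\<in>F. c k *\<^sub>R \<phi> k))\<^sup>2 = (\<Sum>k\<in>F. (c k)\<^sup>2)"
proof -
  have "(norm (\<Sum>k\<in>F. c k *\<^sub>R \<phi> k))\<^sup>2 = (\<Sum>j\<in>F. c j * ((\<Sum>k\<in>F. c k *\<^sub>R \<phi> k) \<bullet> \<phi> j))"
    unfolding power2_norm_eq_inner by (subst inner_sum_right) simp
  also have "\<dots> = (\<Sum>j\<in>F. (c j)\<^sup>2)"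
    using assms by (intro sum.cong) (auto simp: inner_sum_basis power2_eq_square subset_iff)
  finally show ?thesis .
qed

lemma has_sum_basis_norm:
  assumes "((\<lambda>k. c k *\<^sub>R \<phi> k) has_sum L) K"
  shows "((\<lambda>k. (c k)\<^sup>2) has_sum (norm L)\<^sup>2) K"
proof -
  have "((\<lambda>F. (norm (\<Sum>k\<in>F. c k *\<^sub>R \<phi> k))\<^sup>2) \<longlongrightarrow> (norm L)\<^sup>2) (finite_subsets_at_top K)"
    using assms unfolding has_sum_def by (intro tendsto_intros)
  moreover have "\<forall>\<^sub>F F in finite_subsets_at_top K.
      (norm (\<Sum>k\<in>F. c k *\<^sub>R \<phi> k))\<^sup>2 = (\<Sum>k\<in>F. (c k)\<^sup>2)"
    by (intro eventually_finite_subsets_at_top_weakI norm_sum_basis)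
  ultimately show ?thesis unfolding has_sum_def by (rule Lim_transform_eventually)
qed

text \<open>The half of Riesz-Fischer that rests on completeness. By Pythagoras a block of the
  series is as small as the same block of the squares, so the initial segments form a Cauchy
  sequence; the tail bound then upgrades their limit to an unconditional sum.\<close>

lemma summable_basis:
  assumes "(\<lambda>k. (c k)\<^sup>2) summable_on K"
  shows "(\<lambda>k. c k *\<^sub>R \<phi> k) summable_on K"
proof -
  define g where "g N = (\<Sum>k\<in>K \<inter> {..<N}. c k *\<^sub>R \<phi> k)" for N
  have tail: "\<exists>N. \<forall>F. finite F \<and> F \<subseteq> K - {..<N} \<longrightarrow> norm (\<Sum>k\<in>F. c k *\<^sub>R \<phi> k) < e"
    if "0 < e" for e
  proof -
    have "0 < e\<^sup>2" using that by simp
    obtain N where N: "\<And>F. finite F \<Longrightarrow> F \<subseteq> K - {..<N} \<Longrightarrow> (\<Sum>k\<in>F. (c k)\<^sup>2) < e\<^sup>2"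
      using summable_nonneg_tail[OF assms _ \<open>0 < e\<^sup>2\<close>] by auto
    have "norm (\<Sum>k\<in>F. c k *\<^sub>R \<phi> k) < e" if F: "finite F" "F \<subseteq> K - {..<N}" for F
    proof -
      have "(norm (\<Sum>k\<in>F. c k *\<^sub>R \<phi> k))\<^sup>2 < e\<^sup>2"
        using N[OF F] norm_sum_basis[OF F(1), of c] F(2) by (simp add: subset_iff)
      then show ?thesis using \<open>0 < e\<close> by (simp add: power2_less_imp_less)
    qed
    then show ?thesis by blast
  qed
  have "Cauchy g"
  proof (rule CauchyI')
    fix e :: real assume "0 < e"
    then obtain N where N: "\<And>F. finite F \<Longrightarrow> F \<subseteq> K - {..<N} \<Longrightarrow> norm (\<Sum>k\<in>F. c k *\<^sub>R \<phi> k) < e"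
      using tail[of e] by auto
    have "norm (g m - g n) < e" if "m \<ge> N" "m < n" for m n
    proof -
      have "g n = (\<Sum>k\<in>K \<inter> {..<n} - K \<inter> {..<m}. c k *\<^sub>R \<phi> k) + g m"
        unfolding g_def using that by (intro sum.subset_diff) auto
      then have "norm (g m - g n) = norm (\<Sum>k\<in>K \<inter> {..<n} - K \<inter> {..<m}. c k *\<^sub>R \<phi> k)"
        by (simp add: norm_minus_commute)
      also have "\<dots> < e" using that by (intro N) auto
      finally show ?thesis .
    qed
    then show "\<exists>M. \<forall>m\<ge>M. \<forall>n>m. dist (g m) (g n) < e" unfolding dist_norm by blast
  qed
  then have "convergent g" by (rule Cauchy_convergent)
  then obtain L where "g \<longlonglongrightarrow> L" unfolding convergent_def ..
  then have "((\<lambda>k. c k *\<^sub>R \<phi> k) has_sum L) K"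
    unfolding g_def using tail by (rule has_sum_nat_tail)
  then show ?thesis by (rule has_sum_imp_summable)
qed

text \<open>The two series converge together, and when they diverge both sides take the default
  value 0.\<close>

lemma norm_infsum_basis:
  "(norm (\<Sum>\<^sub>\<infinity>k\<in>K. c k *\<^sub>R \<phi> k))\<^sup>2 = (\<Sum>\<^sub>\<infinity>k\<in>K. (c k)\<^sup>2)"
proof (cases "(\<lambda>k. c k *\<^sub>R \<phi> k) summable_on K")
  case True
  then show ?thesis using has_sum_basis_norm[OF has_sum_infsum[OF True]] by (simp add: infsumI)
next
  case False
  moreover from this have "\<not> (\<lambda>k. (c k)\<^sup>2) summable_on K"
    using summable_basis[of c] by blast
  ultimately show ?thesis by (simp add: infsum_not_exists)
qed

text \<open>The squared coordinate of \<Gamma> to the power -t/2 applied to u: the eigenvalue is the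
  square of \<open>lam k\<close>, which turns the exponent -t/2 into -t.\<close>

definition coeff_sq :: "real \<Rightarrow> 'h \<Rightarrow> nat \<Rightarrow> real" where
  "coeff_sq t u k = (lam k powr (- t) * (u \<bullet> \<phi> k))\<^sup>2"

lemma coeff_sq_nonneg [simp]: "0 \<le> coeff_sq t u k"
  by (simp add: coeff_sq_def)

lemma op_power_dom_iff: "u \<in> op_power_dom K lam \<phi> r \<longleftrightarrow> coeff_sq (- 2 * r) u summable_on K"
  by (simp add: op_power_dom_def coeff_sq_def[abs_def])

lemma hs_norm_sq: "(hs_norm K lam \<phi> t u)\<^sup>2 = infsum (coeff_sq t u) K"
  by (simp add: hs_norm_def op_power_def norm_infsum_basis coeff_sq_def[abs_def])

lemma hs_norm_nonneg [simp]: "0 \<le> hs_norm K lam \<phi> t u"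
  by (simp add: hs_norm_def)

lemma hs_norm_eq: "hs_norm K lam \<phi> t u = sqrt (infsum (coeff_sq t u) K)"
  by (metis hs_norm_sq hs_norm_nonneg real_sqrt_unique)

lemma coeff_sq_commute: "coeff_sq t (u - v) = coeff_sq t (v - u)"
  by (rule ext) (simp add: coeff_sq_def power2_eq_square algebra_simps)

text \<open>Stands in for the triangle inequality: being linear in the squares, it can be summed
  term by term, and the factor lost only affects constants.\<close>

lemma coeff_sq_diff_le: "coeff_sq t (u - v) k \<le> 2 * coeff_sq t u k + 2 * coeff_sq t v k"
proof -
  have "(x - y)\<^sup>2 \<le> 2 * x\<^sup>2 + 2 * y\<^sup>2" for x y :: real
    using zero_le_power2[of "x + y"] by (simp add: power2_eq_square algebra_simps)
  from this[of "lam k powr (- t) * (u \<bullet> \<phi> k)" "lam k powr (- t) * (v \<bullet> \<phi> k)"] show ?thesis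
    by (simp add: coeff_sq_def algebra_simps)
qed

lemma summable_coeff_sq_diff:
  assumes "coeff_sq t u summable_on K" "coeff_sq t v summable_on K"
  shows "coeff_sq t (u - v) summable_on K"
    and "infsum (coeff_sq t (u - v)) K \<le> 2 * infsum (coeff_sq t u) K + 2 * infsum (coeff_sq t v) K"
proof -
  have s: "(\<lambda>k. 2 * coeff_sq t u k) summable_on K" "(\<lambda>k. 2 * coeff_sq t v k) summable_on K"
    by (intro summable_on_cmult_right assms)+
  show d: "coeff_sq t (u - v) summable_on K"
    by (rule summable_on_comparison_test[OF summable_on_add[OF s]]) (auto intro: coeff_sq_diff_le)
  have "infsum (coeff_sq t (u - v)) K \<le> (\<Sum>\<^sub>\<infinity>k\<in>K. 2 * coeff_sq t u k + 2 * coeff_sq t v k)"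
    by (intro infsum_mono d summable_on_add s coeff_sq_diff_le)
  also have "\<dots> = 2 * infsum (coeff_sq t u) K + 2 * infsum (coeff_sq t v) K"
    by (subst infsum_add[OF s]) (simp only: infsum_cmult_right')
  finally show "infsum (coeff_sq t (u - v)) K
      \<le> 2 * infsum (coeff_sq t u) K + 2 * infsum (coeff_sq t v) K" .
qed

text \<open>Truncations have finitely many nonzero coordinates, hence lie in the domain of every
  power of \<Gamma>. They supply the Cauchy sequences by which a vector enters the
  completion.\<close>

definition truncation :: "nat \<Rightarrow> 'h \<Rightarrow> 'h" where
  "truncation N u = (\<Sum>k\<in>K \<inter> {..<N}. (u \<bullet> \<phi> k) *\<^sub>R \<phi> k)"

lemma inner_truncation:
  "j \<in> K \<Longrightarrow> truncation N u \<bullet> \<phi> j = (if j < N then u \<bullet> \<phi> j else 0)"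
  by (simp add: truncation_def inner_sum_basis)

text \<open>The remainder is orthogonal to the projection. Both Bessel's inequality and the
  contraction bound for truncations are read off from this identity.\<close>

lemma norm_diff_sum_basis:
  assumes "finite F" "F \<subseteq> K"
  shows "(norm (u - (\<Sum>k\<in>F. (u \<bullet> \<phi> k) *\<^sub>R \<phi> k)))\<^sup>2 = (norm u)\<^sup>2 - (\<Sum>k\<in>F. (u \<bullet> \<phi> k)\<^sup>2)"
proof -
  let ?p = "\<Sum>k\<in>F. (u \<bullet> \<phi> k) *\<^sub>R \<phi> k"
  have "u \<bullet> ?p = (\<Sum>k\<in>F. (u \<bullet> \<phi> k)\<^sup>2)"
    by (simp add: inner_sum_right power2_eq_square)
  moreover have "?p \<bullet> ?p = (\<Sum>k\<in>F. (u \<bullet> \<phi> k)\<^sup>2)"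
    using norm_sum_basis[OF assms] by (simp add: power2_norm_eq_inner)
  ultimately show ?thesis
    by (simp add: power2_norm_eq_inner inner_diff_left inner_diff_right inner_commute)
qed

lemma norm_diff_truncation_le: "norm (u - truncation N u) \<le> norm u"
  using norm_diff_sum_basis[of "K \<inter> {..<N}" u]
  by - (rule power2_le_imp_le, auto simp: truncation_def sum_nonneg)

lemma summable_coeff_sq_0: "coeff_sq 0 u summable_on K"
proof (rule nonneg_bdd_above_summable_on)
  have "sum (coeff_sq 0 u) F \<le> (norm u)\<^sup>2" if "F \<subseteq> K" "finite F" for F
  proof -
    have "sum (coeff_sq 0 u) F = (\<Sum>k\<in>F. (u \<bullet> \<phi> k)\<^sup>2)"
      using that eigenvalue_pos by (intro sum.cong) (force simp: coeff_sq_def)+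
    then show ?thesis
      using norm_diff_sum_basis[OF that(2,1), of u]
        zero_le_power2[of "norm (u - (\<Sum>k\<in>F. (u \<bullet> \<phi> k) *\<^sub>R \<phi> k))"] by linarith
  qed
  then show "bdd_above (sum (coeff_sq 0 u) ` {F. F \<subseteq> K \<and> finite F})"
    by (intro bdd_aboveI[of _ "(norm u)\<^sup>2"]) auto
qed simp

text \<open>Finitely many \<open>lam k\<close> may exceed 1, and there the weights decrease in the
  order. Hence the comparison series adds the order-0 coefficients to those of order t.\<close>

lemma summable_coeff_sq_mono:
  assumes "coeff_sq t u summable_on K" "0 \<le> r" "r \<le> t"
  shows "coeff_sq r u summable_on K"
proof (rule summable_on_comparison_test)
  show "(\<lambda>k. coeff_sq 0 u k + coeff_sq t u k) summable_on K"
    by (intro summable_on_add summable_coeff_sq_0 assms)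
  fix k assume k: "k \<in> K"
  have "(lam k powr (- r))\<^sup>2 \<le> 1 + (lam k powr (- t))\<^sup>2"
  proof (cases "lam k \<ge> 1")
    case True
    then have "lam k powr (- r) \<le> lam k powr 0" using assms by (intro powr_mono) auto
    then have "(lam k powr (- r))\<^sup>2 \<le> 1" using True by (intro power_le_one) auto
    then show ?thesis by (smt (verit) zero_le_power2)
  next
    case False
    then have "lam k powr (- r) \<le> lam k powr (- t)"
      using assms eigenvalue_pos[OF k] by (intro powr_mono') auto
    then have "(lam k powr (- r))\<^sup>2 \<le> (lam k powr (- t))\<^sup>2" by (intro power_mono) auto
    then show ?thesis by (simp add: power_mono add_increasing)
  qed
  then have "(lam k powr (- r))\<^sup>2 * (u \<bullet> \<phi> k)\<^sup>2 \<le> (1 + (lam k powr (- t))\<^sup>2) * (u \<bullet> \<phi> k)\<^sup>2"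
    by (intro mult_right_mono) auto
  then show "coeff_sq r u k \<le> coeff_sq 0 u k + coeff_sq t u k"
    using eigenvalue_pos[OF k] by (simp add: coeff_sq_def power_mult_distrib algebra_simps)
qed simp

lemma truncation_diff: "truncation N (u - v) = truncation N u - truncation N v"
  by (simp add: truncation_def inner_diff_left scaleR_diff_left sum_subtractf)

lemma truncation_scaleR: "truncation N (c *\<^sub>R u) = c *\<^sub>R truncation N u"
  by (simp add: truncation_def scaleR_sum_right)

lemma eventually_truncation_span:
  assumes "v \<in> span (\<phi> ` K)"
  shows "\<forall>\<^sub>F N in sequentially. truncation N v = v"
proof -
  \<comment> \<open>The vectors fixed by all late truncations form a subspace containing the basis,
    hence they contain its span.\<close>
  let ?S = "{v. \<forall>\<^sub>F N in sequentially. truncation N v = v}"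
  have "subspace ?S"
  proof (rule subspaceI)
    show "0 \<in> ?S" by (simp add: truncation_def)
  next
    fix x y assume "x \<in> ?S" "y \<in> ?S"
    then have "\<forall>\<^sub>F N in sequentially. truncation N x = x \<and> truncation N y = y"
      by (auto intro: eventually_conj)
    then show "x + y \<in> ?S"
      by (auto simp: truncation_def inner_add_left scaleR_add_left sum.distrib elim: eventually_mono)
  next
    fix c x assume "x \<in> ?S"
    then show "c *\<^sub>R x \<in> ?S"
      by (auto elim: eventually_mono simp: truncation_scaleR)
  qed
  moreover have "\<phi> ` K \<subseteq> ?S"
  proof (clarsimp)
    fix j assume j: "j \<in> K"
    have "truncation N (\<phi> j) = \<phi> j" if "N > j" for N
    proof -
      have "truncation N (\<phi> j) = (\<Sum>k\<in>K \<inter> {..<N}. if k = j then \<phi> j else 0)"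
        unfolding truncation_def using j by (intro sum.cong) (auto simp: orthonormal)
      then show ?thesis using that j by simp
    qed
    then show "\<forall>\<^sub>F N in sequentially. truncation N (\<phi> j) = \<phi> j"
      using eventually_gt_at_top[of j] by (rule eventually_mono[rotated])
  qed
  ultimately show ?thesis using span_minimal[of "\<phi> ` K" ?S] assms by auto
qed

lemma truncation_tendsto: "(\<lambda>N. truncation N u) \<longlonglongrightarrow> u"
proof (rule tendstoI)
  fix e :: real assume "0 < e"
  have "u \<in> closure (span (\<phi> ` K))" using complete_basis by simp
  then obtain v where v: "v \<in> span (\<phi> ` K)" "dist v u < e"
    using \<open>0 < e\<close> unfolding closure_approachable by blast
  show "\<forall>\<^sub>F N in sequentially. dist (truncation N u) u < e"
    using eventually_truncation_span[OF v(1)]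
  proof (rule eventually_mono)
    fix N assume "truncation N v = v"
    \<comment> \<open>As the truncation fixes v, the error at u equals the error at u - v, and
      taking the remainder does not increase norms.\<close>
    then have "norm (u - truncation N u) = norm ((u - v) - truncation N (u - v))"
      by (simp add: truncation_diff)
    also have "\<dots> \<le> norm (u - v)" by (rule norm_diff_truncation_le)
    finally show "dist (truncation N u) u < e"
      using v(2) by (simp add: dist_norm norm_minus_commute)
  qed
qed

lemma coeff_sq_truncation:
  "k \<in> K \<Longrightarrow> coeff_sq t (truncation N u - truncation M u) k
    = (if k < N \<longleftrightarrow> k < M then 0 else coeff_sq t u k)"
  by (simp add: coeff_sq_def inner_diff_left inner_truncation)

text \<open>Identifies the completion with a weighted sequence space. Forwards, a Cauchy sequence
  has bounded norms, and the bound survives the ambient limit by lower semicontinuity; backwards,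
  truncations approximate.\<close>

lemma hs_space_iff:
  assumes "0 \<le> t"
  shows "u \<in> hs_space K lam \<phi> t \<longleftrightarrow> coeff_sq t u summable_on K"
proof
  assume "u \<in> hs_space K lam \<phi> t"
  then obtain x where dom: "\<And>i n. coeff_sq (2 * real n) (x i) summable_on K"
    and cau: "\<And>e. 0 < e \<Longrightarrow> \<exists>N. \<forall>i\<ge>N. \<forall>j\<ge>N. hs_norm K lam \<phi> t (x i - x j) < e"
    and lim: "x \<longlonglongrightarrow> u"
    unfolding hs_space_def by (auto simp: op_power_dom_iff)
  obtain n :: nat where n: "t \<le> real n" using real_arch_simple by blast
  have sx: "coeff_sq t (x i) summable_on K" for i
    by (rule summable_coeff_sq_mono[OF dom[of n]]) (use assms n in auto)
  obtain N where N: "\<And>i. i \<ge> N \<Longrightarrow> hs_norm K lam \<phi> t (x i - x N) < 1"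
    using cau[of 1] by auto
  let ?x = "x N"
  define B where "B = 2 + 2 * infsum (coeff_sq t ?x) K"
  have bound: "sum (coeff_sq t (x i)) F \<le> B" if "i \<ge> N" "finite F" "F \<subseteq> K" for i F
  proof -
    have "(hs_norm K lam \<phi> t (x i - ?x))\<^sup>2 \<le> 1"
      using N[OF that(1)] by (intro power_le_one) auto
    then have 1: "infsum (coeff_sq t (x i - ?x)) K \<le> 1" by (simp add: hs_norm_sq)
    have "sum (coeff_sq t (x i)) F \<le> (\<Sum>k\<in>F. 2 * coeff_sq t (x i - ?x) k + 2 * coeff_sq t ?x k)"
    proof (rule sum_mono)
      fix k
      show "coeff_sq t (x i) k \<le> 2 * coeff_sq t (x i - ?x) k + 2 * coeff_sq t ?x k"
        using coeff_sq_diff_le[of t "x i - ?x" "- ?x" k] by (simp add: coeff_sq_def)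
    qed
    also have "\<dots> = 2 * sum (coeff_sq t (x i - ?x)) F + 2 * sum (coeff_sq t ?x) F"
      by (simp add: sum.distrib sum_distrib_left)
    also have "\<dots> \<le> 2 * infsum (coeff_sq t (x i - ?x)) K + 2 * infsum (coeff_sq t ?x) K"
      using that sx by (intro add_mono mult_left_mono finite_sum_le_infsum
          summable_coeff_sq_diff(1)) auto
    finally show ?thesis using 1 by (simp add: B_def)
  qed
  show "coeff_sq t u summable_on K"
  proof (rule nonneg_bdd_above_summable_on)
    \<comment> \<open>A finite partial sum is continuous in the ambient norm, so the uniform bound B
      passes to u although nothing is known yet about convergence in the norm of order t.\<close>
    have "sum (coeff_sq t u) F \<le> B" if "F \<subseteq> K" "finite F" for F
    proof (rule tendsto_upperbound)
      show "(\<lambda>i. sum (coeff_sq t (x i)) F) \<longlonglongrightarrow> sum (coeff_sq t u) F"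
        unfolding coeff_sq_def by (intro tendsto_intros lim)
      show "\<forall>\<^sub>F i in sequentially. sum (coeff_sq t (x i)) F \<le> B"
        using eventually_ge_at_top[of N] by (rule eventually_mono) (use bound that in auto)
    qed simp
    then show "bdd_above (sum (coeff_sq t u) ` {F. F \<subseteq> K \<and> finite F})"
      by (intro bdd_aboveI[of _ B]) auto
  qed simp
next
  assume s: "coeff_sq t u summable_on K"
  have dom: "truncation N u \<in> op_power_dom K lam \<phi> (- real n)" for N n
  proof -
    have "coeff_sq r (truncation N u) summable_on K" for r
      by (rule finite_nonzero_values_imp_summable_on, rule finite_subset[of _ "{..<N}"])
        (auto simp: coeff_sq_def inner_truncation split: if_splits)
    then show ?thesis by (simp add: op_power_dom_iff)
  qed
  have cau: "\<exists>N. \<forall>i\<ge>N. \<forall>j\<ge>N. hs_norm K lam \<phi> t (truncation i u - truncation j u) < e"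
    if "0 < e" for e
  proof -
    have "0 < e\<^sup>2" using that by simp
    obtain N where N: "\<And>F. finite F \<Longrightarrow> F \<subseteq> K - {..<N} \<Longrightarrow> sum (coeff_sq t u) F < e\<^sup>2"
      using summable_nonneg_tail[OF s _ \<open>0 < e\<^sup>2\<close>] by auto
    have "hs_norm K lam \<phi> t (truncation i u - truncation j u) < e" if "i \<ge> N" "j \<ge> N" for i j
    proof -
      let ?F = "K \<inter> ({..<i} - {..<j} \<union> ({..<j} - {..<i}))"
      \<comment> \<open>Only the coordinates between the two cutoffs survive. They are finitely many
        and all lie beyond N.\<close>
      have "infsum (coeff_sq t (truncation i u - truncation j u)) K = infsum (coeff_sq t u) ?F"
        by (rule infsum_cong_neutral) (auto simp: coeff_sq_truncation)
      also have "\<dots> = sum (coeff_sq t u) ?F" by simp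
      also have "\<dots> < e\<^sup>2" using that by (intro N) auto
      finally show ?thesis
        using \<open>0 < e\<close> unfolding hs_norm_sq[symmetric] by (rule power2_less_imp_less[OF _ less_imp_le])
    qed
    then show ?thesis by blast
  qed
  show "u \<in> hs_space K lam \<phi> t"
    unfolding hs_space_def using dom cau truncation_tendsto
    by (intro CollectI exI[of _ "\<lambda>N. truncation N u"]) auto
qed

end

section \<open>Measurability, interpolation and the noise\<close>

lemma nn_integral_normal_density_power2:
  assumes "0 < \<sigma>"
  shows "(\<integral>\<^sup>+z. ennreal (z\<^sup>2) \<partial>density lborel (\<lambda>z. ennreal (normal_density 0 \<sigma> z))) = ennreal (\<sigma>\<^sup>2)"
proof -
  have I: "has_bochner_integral lborel (\<lambda>z. normal_density 0 \<sigma> z * z\<^sup>2) (\<sigma>\<^sup>2)"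
    using normal_moment_even[OF assms, of 0 1] by (simp add: fact_numeral)
  have "(\<integral>\<^sup>+z. ennreal (z\<^sup>2) \<partial>density lborel (\<lambda>z. ennreal (normal_density 0 \<sigma> z)))
      = (\<integral>\<^sup>+z. ennreal (normal_density 0 \<sigma> z * z\<^sup>2) \<partial>lborel)"
    by (subst nn_integral_density) (auto simp: ennreal_mult)
  also have "\<dots> = ennreal (\<integral>z. normal_density 0 \<sigma> z * z\<^sup>2 \<partial>lborel)"
    using I by (intro nn_integral_eq_integral) (auto simp: has_bochner_integral_iff)
  finally show ?thesis using I by (simp add: has_bochner_integral_iff)
qed

lemma nn_integral_count_space_le_imp_summable:
  fixes f :: "'a \<Rightarrow> real"
  assumes "\<And>k. k \<in> A \<Longrightarrow> 0 \<le> f k" "(\<integral>\<^sup>+k. ennreal (f k) \<partial>count_space A) \<le> ennreal T" "0 \<le> T"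
  shows "f summable_on A" "infsum f A \<le> T"
proof -
  have i: "integrable (count_space A) f"
    using assms by (intro integrableI_nonneg) (auto simp: AE_count_space intro: le_less_trans)
  then show "f summable_on A" by (simp add: integrable_count_space_iff_summable_on)
  have "(\<integral>\<^sup>+k. ennreal (f k) \<partial>count_space A) = ennreal (infsum f A)"
    unfolding infsum_eq_integral_count_space
    using i assms(1) by (intro nn_integral_eq_integral) (auto simp: AE_count_space)
  then show "infsum f A \<le> T" using assms by (simp add: ennreal_le_iff)
qed

context covariance_operator
begin

section \<open>Borel measurability through coordinates\<close>

lemma measurable_inner_basis:
  assumes "f \<in> borel_measurable M"
  shows "(\<lambda>x. f x \<bullet> \<phi> k) \<in> borel_measurable M"
  by (rule measurable_compose[OF assms])
    (intro borel_measurable_continuous_onI continuous_intros)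

lemma measurable_coeff_sq:
  "f \<in> borel_measurable M \<Longrightarrow> (\<lambda>x. coeff_sq t (f x) k) \<in> borel_measurable M"
  unfolding coeff_sq_def by (intro measurable_inner_basis borel_measurable_power borel_measurable_times borel_measurable_const)

lemma measurable_hs_norm:
  "f \<in> borel_measurable M \<Longrightarrow> (\<lambda>x. hs_norm K lam \<phi> t (f x)) \<in> borel_measurable M"
  unfolding hs_norm_eq
  by (intro measurable_compose[OF _ borel_measurable_sqrt] borel_measurable_infsum_real measurable_coeff_sq)

lemma measurable_hs_pairing:
  assumes "f \<in> borel_measurable M" "g \<in> borel_measurable M"
  shows "(\<lambda>x. hs_pairing K lam \<phi> (f x) (g x)) \<in> borel_measurable M"
  unfolding hs_pairing_def
  by (intro borel_measurable_infsum_real borel_measurable_times borel_measurable_const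
      measurable_inner_basis assms)

text \<open>One argument is constant so that subtraction is a continuous map of a single variable:
  the type \<open>'h\<close> is not declared second countable, so measurability does not pass
  through pairs of vector-valued functions.\<close>

lemma measurable_diff_const:
  fixes a :: 'h
  assumes "f \<in> borel_measurable M"
  shows "(\<lambda>x. f x - a) \<in> borel_measurable M" "(\<lambda>x. a - f x) \<in> borel_measurable M"
  by (rule measurable_compose[OF assms], intro borel_measurable_continuous_onI continuous_intros)+

lemma measurable_likelihood:
  assumes "f \<in> borel_measurable M" "g \<in> borel_measurable M"
  shows "(\<lambda>x. likelihood K lam \<phi> a n (g x) (f x)) \<in> borel_measurable M"
proof -
  have [measurable]: "(\<lambda>x. hs_norm K lam \<phi> 1 (f x - a)) \<in> borel_measurable M"
    "(\<lambda>x. hs_pairing K lam \<phi> (f x - a) (g x)) \<in> borel_measurable M"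
    by (intro measurable_hs_norm measurable_hs_pairing measurable_diff_const assms)+
  show ?thesis unfolding likelihood_def by measurable
qed

lemma hs_ball_measurable:
  assumes "0 \<le> t"
  shows "hs_ball K lam \<phi> t a R \<in> sets borel"
proof -
  have [measurable]: "Measurable.pred borel (\<lambda>x. coeff_sq t (a - x) summable_on K)"
    by (intro pred_summable_on_real measurable_coeff_sq measurable_diff_const) simp
  have [measurable]: "(\<lambda>x. hs_norm K lam \<phi> t (a - x)) \<in> borel_measurable borel"
    by (intro measurable_hs_norm measurable_diff_const) simp
  show ?thesis
    unfolding hs_ball_def hs_space_iff[OF assms] by measurable
qed

text \<open>The norms are log-convex in the order: each coefficient of order t is the weighted
  geometric mean of those of orders p and q, so both claims come from Hoelder's inequality.\<close>

lemma interpolation: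
  assumes s: "coeff_sq p u summable_on K" "coeff_sq q u summable_on K"
    and \<theta>: "0 < \<theta>" "\<theta> < 1" and t: "t = \<theta> * p + (1 - \<theta>) * q"
  shows "coeff_sq t u summable_on K"
    and "hs_norm K lam \<phi> t u \<le> hs_norm K lam \<phi> p u powr \<theta> * hs_norm K lam \<phi> q u powr (1 - \<theta>)"
proof -
  have eq: "coeff_sq t u k = coeff_sq p u k powr \<theta> * coeff_sq q u k powr (1 - \<theta>)" if "k \<in> K" for k
  proof -
    let ?c = "(u \<bullet> \<phi> k)\<^sup>2"
    have l: "0 < lam k" by (rule eigenvalue_pos[OF that])
    have sq: "coeff_sq r u k = lam k powr (- 2 * r) * ?c" for r
      using l by (simp add: coeff_sq_def power_mult_distrib powr_power mult.commute)
    have "coeff_sq p u k powr \<theta> * coeff_sq q u k powr (1 - \<theta>)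
        = (lam k powr (- 2 * p * \<theta>) * lam k powr (- 2 * q * (1 - \<theta>))) * (?c powr \<theta> * ?c powr (1 - \<theta>))"
      unfolding sq using l by (simp add: powr_mult powr_powr mult_ac)
    also have "\<dots> = lam k powr (- 2 * t) * ?c powr 1"
      unfolding powr_add[symmetric] t by (simp add: algebra_simps)
    finally show ?thesis unfolding sq by simp
  qed
  have \<theta>': "0 < 1 - \<theta>" "\<theta> + (1 - \<theta>) = 1" using \<theta> by auto
  note H = Hoelder_infsum[OF s(1) _ s(2) _ \<theta>(1) \<theta>', OF coeff_sq_nonneg coeff_sq_nonneg]
  have *: "infsum (coeff_sq t u) K = (\<Sum>\<^sub>\<infinity>k\<in>K. coeff_sq p u k powr \<theta> * coeff_sq q u k powr (1 - \<theta>))"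
    by (intro infsum_cong eq)
  show "coeff_sq t u summable_on K"
    using H(1) by (subst summable_on_cong[OF eq])
  have "hs_norm K lam \<phi> t u \<le> sqrt (infsum (coeff_sq p u) K powr \<theta> * infsum (coeff_sq q u) K powr (1 - \<theta>))"
    unfolding hs_norm_eq[of t] * using H(2) by simp
  also have "\<dots> = hs_norm K lam \<phi> p u powr \<theta> * hs_norm K lam \<phi> q u powr (1 - \<theta>)"
    unfolding hs_norm_sq[symmetric]
    by (simp add: real_sqrt_mult power2_eq_square powr_mult)
  finally show "hs_norm K lam \<phi> t u
      \<le> hs_norm K lam \<phi> p u powr \<theta> * hs_norm K lam \<phi> q u powr (1 - \<theta>)" .
qed

text \<open>The weight of order 2 splits as (1 + \<sigma>) + (1 - \<sigma>), one part for each
  argument; Cauchy-Schwarz does the rest.\<close>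

lemma abs_hs_pairing_le:
  assumes "coeff_sq (1 + \<sigma>) u summable_on K" "coeff_sq (1 - \<sigma>) x summable_on K"
  shows "\<bar>hs_pairing K lam \<phi> u x\<bar> \<le> hs_norm K lam \<phi> (1 + \<sigma>) u * hs_norm K lam \<phi> (1 - \<sigma>) x"
proof -
  let ?f = "\<lambda>k. lam k powr (- 2) * (u \<bullet> \<phi> k) * (x \<bullet> \<phi> k)"
  let ?g = "\<lambda>k. coeff_sq (1 + \<sigma>) u k powr (1/2) * coeff_sq (1 - \<sigma>) x k powr (1/2)"
  have eq: "\<bar>?f k\<bar> = ?g k" if "k \<in> K" for k
  proof -
    have l: "0 < lam k" by (rule eigenvalue_pos[OF that])
    have "?g k = (lam k powr (- (1 + \<sigma>)) * lam k powr (- (1 - \<sigma>))) * \<bar>u \<bullet> \<phi> k\<bar> * \<bar>x \<bullet> \<phi> k\<bar>"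
      by (simp add: coeff_sq_def abs_mult)
    also have "lam k powr (- (1 + \<sigma>)) * lam k powr (- (1 - \<sigma>)) = lam k powr (- 2)"
      using l by (simp flip: powr_add)
    finally show ?thesis by (simp add: abs_mult)
  qed
  note H = Hoelder_infsum[OF assms(1) _ assms(2), OF coeff_sq_nonneg coeff_sq_nonneg, of "1/2" "1/2"]
  have "(\<lambda>k. norm (?f k)) summable_on K"
    using H(1) summable_on_cong[of K "\<lambda>k. norm (?f k)" ?g] eq by simp
  then have "\<bar>infsum ?f K\<bar> \<le> (\<Sum>\<^sub>\<infinity>k\<in>K. norm (?f k))"
    using norm_infsum_bound[of ?f K] by simp
  also have "\<dots> = infsum ?g K" using eq by (intro infsum_cong) simp
  also have "\<dots> \<le> hs_norm K lam \<phi> (1 + \<sigma>) u * hs_norm K lam \<phi> (1 - \<sigma>) x"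
    using H(2) by (simp add: hs_norm_eq powr_half_sqrt infsum_nonneg)
  finally show ?thesis by (simp add: hs_pairing_def)
qed

section \<open>Second moments of the noise\<close>

lemma noise_coordinate_second_moment:
  assumes "centred_gaussian \<Gamma> (distr P borel \<xi>)" and \<xi>: "\<xi> \<in> borel_measurable P" and k: "k \<in> K"
  shows "(\<integral>\<^sup>+\<omega>. ennreal ((\<xi> \<omega> \<bullet> \<phi> k)\<^sup>2) \<partial>P) = ennreal ((lam k)\<^sup>2)"
proof -
  have l: "0 < lam k" by (rule eigenvalue_pos[OF k])
  have "\<Gamma> (\<phi> k) \<bullet> \<phi> k = (lam k)\<^sup>2" using k by (simp add: eigenpair orthonormal)
  \<comment> \<open>A positive eigenvalue excludes the degenerate branch of
    \<open>centred_gaussian\<close>.\<close>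
  then have d: "distr (distr P borel \<xi>) borel (\<lambda>x. x \<bullet> \<phi> k)
      = density lborel (\<lambda>z. ennreal (normal_density 0 (lam k) z))"
    using assms(1) l unfolding centred_gaussian_def by (simp add: less_imp_le)
  have m: "(\<lambda>x. x \<bullet> \<phi> k) \<in> borel_measurable (distr P borel \<xi>)"
    by (simp add: measurable_inner_basis[of "\<lambda>x. x"])
  have m2: "(\<lambda>x. ennreal ((x \<bullet> \<phi> k)\<^sup>2)) \<in> borel_measurable (distr P borel \<xi>)"
    by (rule measurable_compose[OF m]) simp
  have "(\<integral>\<^sup>+\<omega>. ennreal ((\<xi> \<omega> \<bullet> \<phi> k)\<^sup>2) \<partial>P)
      = (\<integral>\<^sup>+x. ennreal ((x \<bullet> \<phi> k)\<^sup>2) \<partial>distr P borel \<xi>)"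
    using nn_integral_distr[OF \<xi> m2] by simp
  also have "\<dots> = (\<integral>\<^sup>+z. ennreal (z\<^sup>2) \<partial>distr (distr P borel \<xi>) borel (\<lambda>x. x \<bullet> \<phi> k))"
    using nn_integral_distr[OF m, of "\<lambda>z. ennreal (z\<^sup>2)"] by simp
  finally show ?thesis using l by (simp add: d nn_integral_normal_density_power2)
qed

text \<open>Markov's inequality: the squared norm of order \<open>1 - \<sigma>\<close> of the noise has mean
  \<open>tr \<Gamma>\<^sup>\<sigma>\<close>.\<close>

lemma noise_norm_tail:
  assumes P: "prob_space P" and cg: "centred_gaussian \<Gamma> (distr P borel \<xi>)"
    and \<xi>: "\<xi> \<in> borel_measurable P"
    and trace: "(\<lambda>k. lam k powr (2 * \<sigma>)) summable_on K" and T: "0 < T"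
  obtains E where "E \<in> sets P"
    "\<And>\<omega>. \<omega> \<in> E \<Longrightarrow> coeff_sq (1 - \<sigma>) (\<xi> \<omega>) summable_on K"
    "\<And>\<omega>. \<omega> \<in> E \<Longrightarrow> (hs_norm K lam \<phi> (1 - \<sigma>) (\<xi> \<omega>))\<^sup>2 \<le> T"
    "1 - (\<Sum>\<^sub>\<infinity>k\<in>K. lam k powr (2 * \<sigma>)) / T \<le> measure P E"
proof -
  interpret prob_space P by (rule P)
  let ?C = "\<Sum>\<^sub>\<infinity>k\<in>K. lam k powr (2 * \<sigma>)"
  have C: "0 \<le> ?C" by (intro infsum_nonneg) simp
  \<comment> \<open>V takes values in the extended nonnegative reals, so a finite bound on it yields
    summability and the norm bound together. The real-valued \<open>hs_norm\<close> would be 0 where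
    the series diverges.\<close>
  define V where "V \<omega> = (\<integral>\<^sup>+k. ennreal (coeff_sq (1 - \<sigma>) (\<xi> \<omega>) k) \<partial>count_space K)" for \<omega>
  have mc[measurable]: "(\<lambda>\<omega>. ennreal (coeff_sq (1 - \<sigma>) (\<xi> \<omega>) k)) \<in> borel_measurable P" for k
    by (rule measurable_compose[OF measurable_coeff_sq[OF \<xi>]]) simp
  have EV: "(\<integral>\<^sup>+\<omega>. V \<omega> \<partial>P) = ennreal ?C"
  proof -
    have "(\<integral>\<^sup>+\<omega>. V \<omega> \<partial>P) = (\<integral>\<^sup>+k. \<integral>\<^sup>+\<omega>. ennreal (coeff_sq (1 - \<sigma>) (\<xi> \<omega>) k) \<partial>P \<partial>count_space K)"
      unfolding V_def by (intro nn_integral_count_space_nn_integral mc) simp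
    also have "\<dots> = (\<integral>\<^sup>+k. ennreal (lam k powr (2 * \<sigma>)) \<partial>count_space K)"
    proof (rule nn_integral_cong)
      fix k assume "k \<in> space (count_space K)"
      then have k: "k \<in> K" by simp
      have l: "0 < lam k" by (rule eigenvalue_pos[OF k])
      have m: "(\<lambda>\<omega>. ennreal ((\<xi> \<omega> \<bullet> \<phi> k)\<^sup>2)) \<in> borel_measurable P"
        by (rule measurable_compose[OF measurable_inner_basis[OF \<xi>]]) simp
      have "(\<integral>\<^sup>+\<omega>. ennreal (coeff_sq (1 - \<sigma>) (\<xi> \<omega>) k) \<partial>P)
          = ennreal ((lam k powr (- (1 - \<sigma>)))\<^sup>2) * (\<integral>\<^sup>+\<omega>. ennreal ((\<xi> \<omega> \<bullet> \<phi> k)\<^sup>2) \<partial>P)"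
        unfolding coeff_sq_def power_mult_distrib by (simp add: ennreal_mult nn_integral_cmult m)
      also have "\<dots> = ennreal ((lam k powr (- (1 - \<sigma>)))\<^sup>2 * (lam k)\<^sup>2)"
        by (simp add: noise_coordinate_second_moment[OF cg \<xi> k] ennreal_mult)
      \<comment> \<open>The variance of the coordinate raises the exponent from \<sigma> - 1 to
        \<sigma>, which leaves the eigenvalue of \<Gamma> to the power \<sigma>.\<close>
      also have "(lam k powr (- (1 - \<sigma>)))\<^sup>2 * (lam k)\<^sup>2 = (lam k powr (- (1 - \<sigma>)) * lam k powr 1)\<^sup>2"
        using l by (simp add: power_mult_distrib)
      also have "\<dots> = (lam k powr \<sigma>)\<^sup>2" by (simp only: powr_add[symmetric]) simp
      also have "\<dots> = lam k powr (2 * \<sigma>)" using l by (simp add: powr_power mult.commute)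
      finally show "(\<integral>\<^sup>+\<omega>. ennreal (coeff_sq (1 - \<sigma>) (\<xi> \<omega>) k) \<partial>P) = ennreal (lam k powr (2 * \<sigma>))" .
    qed
    also have "\<dots> = ennreal ?C"
      unfolding infsum_eq_integral_count_space
      using trace by (intro nn_integral_eq_integral)
        (auto simp: AE_count_space integrable_count_space_iff_summable_on)
    finally show ?thesis .
  qed
  have V[measurable]: "V \<in> borel_measurable P"
  proof -
    interpret K: sigma_finite_measure "count_space K"
      by (rule sigma_finite_measure_count_space_countable) simp
    have "(\<lambda>(\<omega>, k). ennreal (coeff_sq (1 - \<sigma>) (\<xi> \<omega>) k)) \<in> borel_measurable (P \<Otimes>\<^sub>M count_space K)"
      by (intro measurable_pair_count_space mc)
    then show ?thesis unfolding V_def by (rule K.borel_measurable_nn_integral)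
  qed
  define E where "E = {\<omega> \<in> space P. V \<omega> \<le> ennreal T}"
  have E[measurable]: "E \<in> sets P" unfolding E_def by measurable
  have "emeasure P (space P - E) \<le> emeasure P {\<omega> \<in> space P. 1 \<le> ennreal (1 / T) * V \<omega>}"
  proof (rule emeasure_mono)
    show "space P - E \<subseteq> {\<omega> \<in> space P. 1 \<le> ennreal (1 / T) * V \<omega>}"
    proof
      fix \<omega> assume "\<omega> \<in> space P - E"
      then have \<omega>: "\<omega> \<in> space P" "ennreal T \<le> V \<omega>" by (auto simp: E_def)
      have "ennreal (1 / T) * ennreal T \<le> ennreal (1 / T) * V \<omega>"
        using \<omega> by (intro mult_left_mono) auto
      then show "\<omega> \<in> {\<omega> \<in> space P. 1 \<le> ennreal (1 / T) * V \<omega>}"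
        using \<omega> T by (simp add: ennreal_mult[symmetric])
    qed
  qed measurable
  also have "\<dots> \<le> ennreal (1 / T) * (\<integral>\<^sup>+\<omega>. V \<omega> * indicator (space P) \<omega> \<partial>P)"
    by (rule nn_integral_Markov_inequality) auto
  also have "(\<integral>\<^sup>+\<omega>. V \<omega> * indicator (space P) \<omega> \<partial>P) = (\<integral>\<^sup>+\<omega>. V \<omega> \<partial>P)"
    by (intro nn_integral_cong) simp
  also have "ennreal (1 / T) * \<dots> = ennreal (?C / T)"
    using C T by (simp add: EV ennreal_mult[symmetric])
  finally have "prob (space P - E) \<le> ?C / T"
    using C T by (simp add: emeasure_eq_measure)
  then have "1 - ?C / T \<le> prob E" using prob_compl[OF E] by simp
  moreover have "coeff_sq (1 - \<sigma>) (\<xi> \<omega>) summable_on K" "(hs_norm K lam \<phi> (1 - \<sigma>) (\<xi> \<omega>))\<^sup>2 \<le> T"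
    if "\<omega> \<in> E" for \<omega>
    using nn_integral_count_space_le_imp_summable[of K "coeff_sq (1 - \<sigma>) (\<xi> \<omega>)" T] that T
    by (auto simp: E_def V_def hs_norm_sq)
  ultimately show ?thesis using that[OF E] by blast
qed

end

section \<open>Posterior contraction\<close>

text \<open>Here \<open>r\<close> is the distance to the truth and \<open>q\<close> the noise term of the log-likelihood.\<close>

lemma tilted_quadratic_bounds:
  fixes r \<delta> n q :: real
  assumes \<theta>: "0 < \<theta>" "\<theta> < 1" and "0 < \<delta>" "0 \<le> r" "0 \<le> n"
    and q: "\<bar>q\<bar> \<le> n / 4 * (\<delta> powr (2 - \<theta>) * r powr \<theta>)"
  shows "r \<le> \<delta> \<Longrightarrow> - (3/4) * n * \<delta>\<^sup>2 \<le> - (n / 2) * r\<^sup>2 + q"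
    and "2 * \<delta> < r \<Longrightarrow> - (n / 2) * r\<^sup>2 + q \<le> - n * \<delta>\<^sup>2"
    and "- (n / 2) * r\<^sup>2 + q \<le> n / 4 * \<delta>\<^sup>2"
proof -
  \<comment> \<open>The two bounds cross at r = \<delta>: because 0 < \<theta> < 2, replacing the
    smaller of r and \<delta> by the larger one gives a pure square, \<delta>^2 here and r^2 in
    \<open>large\<close>.\<close>
  have small: "\<bar>q\<bar> \<le> n / 4 * \<delta>\<^sup>2" if "r \<le> \<delta>"
  proof -
    have "\<delta> powr (2 - \<theta>) * r powr \<theta> \<le> \<delta> powr (2 - \<theta>) * \<delta> powr \<theta>"
      using that assms by (intro mult_left_mono powr_mono2) auto
    also have "\<dots> = \<delta>\<^sup>2" using assms by (simp flip: powr_add)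
    finally show ?thesis using q assms by (meson divide_nonneg_nonneg mult_left_mono order_trans zero_le_numeral)
  qed
  have large: "\<bar>q\<bar> \<le> n / 4 * r\<^sup>2" if "\<delta> \<le> r"
  proof -
    have "\<delta> powr (2 - \<theta>) * r powr \<theta> \<le> r powr (2 - \<theta>) * r powr \<theta>"
      using that assms by (intro mult_right_mono powr_mono2) auto
    also have "\<dots> = r\<^sup>2" using assms that by (simp flip: powr_add)
    finally show ?thesis using q assms by (meson divide_nonneg_nonneg mult_left_mono order_trans zero_le_numeral)
  qed
  show "- (3/4) * n * \<delta>\<^sup>2 \<le> - (n / 2) * r\<^sup>2 + q" if "r \<le> \<delta>"
  proof -
    have "n / 2 * r\<^sup>2 \<le> n / 2 * \<delta>\<^sup>2" using that assms by (intro mult_left_mono power_mono) auto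
    then show ?thesis using small[OF that] by linarith
  qed
  show "- (n / 2) * r\<^sup>2 + q \<le> - n * \<delta>\<^sup>2" if "2 * \<delta> < r"
  proof -
    \<comment> \<open>A quarter of n r^2 remains after absorbing q, and r > 2 \<delta> makes it at
      least n \<delta>^2. The factor 2 is what beats the 3/4 lost on the small ball.\<close>
    have "n / 4 * (2 * \<delta>)\<^sup>2 \<le> n / 4 * r\<^sup>2" using that assms by (intro mult_left_mono power_mono) auto
    then have "n * \<delta>\<^sup>2 \<le> n / 4 * r\<^sup>2" by (simp add: power_mult_distrib)
    then show ?thesis using large that assms by linarith
  qed
  \<comment> \<open>This bound is uniform in r and serves to make the likelihood integrable.\<close>
  have "0 \<le> n / 4 * r\<^sup>2" "0 \<le> n / 4 * \<delta>\<^sup>2" using assms by auto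
  then show "- (n / 2) * r\<^sup>2 + q \<le> n / 4 * \<delta>\<^sup>2"
    using small large by (cases "r \<le> \<delta>") linarith+
qed

text \<open>Works at one fixed \<sigma> with finite trace, because at \<open>\<sigma>0\<close>
  itself the trace may diverge. The value of \<sigma> is chosen only at the end, depending on the
  rate wanted.\<close>

locale bounded_prior_regression =
  covariance_operator \<Gamma> K lam \<phi> + noise: prob_space P + prior: prob_space \<mu>0
  for \<Gamma> :: "'h::{real_inner, complete_space} \<Rightarrow> 'h" and K lam and \<phi> :: "nat \<Rightarrow> 'h"
    and P :: "'w measure" and \<mu>0 :: "'h measure" +
  fixes \<xi> :: "'w \<Rightarrow> 'h" and a\<^sub>0 :: 'h and s \<sigma> U :: real
  assumes noise_measurable: "\<xi> \<in> borel_measurable P"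
    and noise_gaussian: "centred_gaussian \<Gamma> (distr P borel \<xi>)"
    and sets_prior [measurable_cong]: "sets \<mu>0 = sets borel"
    and \<sigma>_pos: "0 < \<sigma>" and \<sigma>_less: "\<sigma> < s - 1"
    and trace_\<sigma>: "(\<lambda>k. lam k powr (2 * \<sigma>)) summable_on K"
    and prior_bounded: "AE a in \<mu>0. a \<in> hs_space K lam \<phi> s \<and> hs_norm K lam \<phi> s a \<le> U"
    and truth_regular: "a\<^sub>0 \<in> hs_space K lam \<phi> s"
begin

text \<open>The interpolation weight that places 1 + \<sigma> between 1 and s; at \<sigma> =
  \<sigma>0 it would be the \<lambda> of the rate.\<close>

definition \<theta> :: real where "\<theta> = (s - 1 - \<sigma>) / (s - 1)"

lemma \<theta>_bounds: "0 < \<theta>" "\<theta> < 1"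
  using \<sigma>_pos \<sigma>_less by (auto simp: \<theta>_def field_simps)

lemma interpolation_index: "1 + \<sigma> = \<theta> * 1 + (1 - \<theta>) * s"
proof -
  have "(1 - \<theta>) * (s - 1) = \<sigma>" using \<sigma>_pos \<sigma>_less by (simp add: \<theta>_def field_simps)
  then show ?thesis by (simp add: algebra_simps)
qed

text \<open>Bounds the order-s distance from almost every prior draw to the truth. The added 1 keeps
  it positive even when U and the norm of the truth vanish, so that \<open>noise_factor\<close> can
  be divided by.\<close>

definition radius :: real where
  "radius = sqrt (2 * U\<^sup>2 + 2 * (hs_norm K lam \<phi> s a\<^sub>0)\<^sup>2) + 1"

definition noise_factor :: real where "noise_factor = radius powr (1 - \<theta>)"

lemma noise_factor_pos: "0 < noise_factor"
proof -
  have "0 < radius" unfolding radius_def by (smt (verit) real_sqrt_ge_zero zero_le_power2)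
  then show ?thesis by (simp add: noise_factor_def)
qed

text \<open>The quantifier over x stands inside the almost-everywhere statement: one null set of a
  serves all noise realisations, so x may later be random.\<close>

lemma AE_pairing_le:
  "AE a in \<mu>0. coeff_sq 1 (a - a\<^sub>0) summable_on K \<and>
    (\<forall>x. coeff_sq (1 - \<sigma>) x summable_on K \<longrightarrow> \<bar>hs_pairing K lam \<phi> (a - a\<^sub>0) x\<bar>
      \<le> hs_norm K lam \<phi> 1 (a - a\<^sub>0) powr \<theta> * noise_factor * hs_norm K lam \<phi> (1 - \<sigma>) x)"
  using prior_bounded
proof eventually_elim
  fix a assume a: "a \<in> hs_space K lam \<phi> s \<and> hs_norm K lam \<phi> s a \<le> U"
  have s: "0 \<le> s" "1 \<le> s" using \<sigma>_pos \<sigma>_less by auto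
  let ?u = "a - a\<^sub>0"
  have sm: "coeff_sq s a summable_on K" "coeff_sq s a\<^sub>0 summable_on K"
    using a truth_regular hs_space_iff[OF s(1)] by auto
  have us: "coeff_sq s ?u summable_on K" by (rule summable_coeff_sq_diff(1)[OF sm])
  have u1: "coeff_sq 1 ?u summable_on K" by (rule summable_coeff_sq_mono[OF us]) (use s in auto)
  have "(hs_norm K lam \<phi> s a)\<^sup>2 \<le> U\<^sup>2" using a by (intro power_mono) auto
  then have "(hs_norm K lam \<phi> s ?u)\<^sup>2 \<le> 2 * U\<^sup>2 + 2 * (hs_norm K lam \<phi> s a\<^sub>0)\<^sup>2"
    using summable_coeff_sq_diff(2)[OF sm] by (simp add: hs_norm_sq)
  then have "hs_norm K lam \<phi> s ?u \<le> sqrt (2 * U\<^sup>2 + 2 * (hs_norm K lam \<phi> s a\<^sub>0)\<^sup>2)"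
    by (rule real_le_rsqrt)
  then have rad: "hs_norm K lam \<phi> s ?u powr (1 - \<theta>) \<le> noise_factor"
    unfolding noise_factor_def radius_def using \<theta>_bounds by (intro powr_mono2) auto
  note int = interpolation[OF u1 us \<theta>_bounds interpolation_index]
  have "\<bar>hs_pairing K lam \<phi> ?u x\<bar>
      \<le> hs_norm K lam \<phi> 1 ?u powr \<theta> * noise_factor * hs_norm K lam \<phi> (1 - \<sigma>) x"
    if x: "coeff_sq (1 - \<sigma>) x summable_on K" for x
  proof -
    have "\<bar>hs_pairing K lam \<phi> ?u x\<bar> \<le> hs_norm K lam \<phi> (1 + \<sigma>) ?u * hs_norm K lam \<phi> (1 - \<sigma>) x"
      by (rule abs_hs_pairing_le[OF int(1) x])
    also have "\<dots> \<le> (hs_norm K lam \<phi> 1 ?u powr \<theta> * noise_factor) * hs_norm K lam \<phi> (1 - \<sigma>) x"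
      by (intro mult_right_mono order_trans[OF int(2)] mult_left_mono rad) auto
    finally show ?thesis .
  qed
  then show "coeff_sq 1 ?u summable_on K \<and>
    (\<forall>x. coeff_sq (1 - \<sigma>) x summable_on K \<longrightarrow> \<bar>hs_pairing K lam \<phi> ?u x\<bar>
      \<le> hs_norm K lam \<phi> 1 ?u powr \<theta> * noise_factor * hs_norm K lam \<phi> (1 - \<sigma>) x)"
    using u1 by blast
qed

text \<open>A deterministic estimate for one noise realisation. Numerator and normalising constant
  are compared directly, so no concentration of the normalising constant is required.\<close>

lemma posterior_ball_ge:
  assumes x: "coeff_sq (1 - \<sigma>) x summable_on K"
    and \<delta>: "0 < \<delta>" and R: "2 * \<delta> \<le> R"
    and noise: "4 * noise_factor * hs_norm K lam \<phi> (1 - \<sigma>) x \<le> sqrt (real n) * \<delta> powr (2 - \<theta>)"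
    and m: "0 < measure \<mu>0 (hs_ball K lam \<phi> 1 a\<^sub>0 \<delta>)"
  shows "1 - exp (- (real n * \<delta>\<^sup>2 / 4)) / measure \<mu>0 (hs_ball K lam \<phi> 1 a\<^sub>0 \<delta>)
    \<le> measure (posterior K lam \<phi> \<mu>0 a\<^sub>0 n x) (hs_ball K lam \<phi> 1 a\<^sub>0 R)"
proof -
  let ?L = "\<lambda>a. likelihood K lam \<phi> a\<^sub>0 n x a"
  let ?r = "\<lambda>a. hs_norm K lam \<phi> 1 (a - a\<^sub>0)"
  let ?B = "hs_ball K lam \<phi> 1 a\<^sub>0"
  let ?m = "measure \<mu>0 (?B \<delta>)"
  let ?n = "real n"
  have B[measurable]: "?B \<rho> \<in> sets borel" for \<rho> by (rule hs_ball_measurable) simp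
  have L[measurable]: "?L \<in> borel_measurable borel"
    by (rule measurable_likelihood) auto
  have ball: "a \<in> ?B \<rho> \<longleftrightarrow> coeff_sq 1 (a - a\<^sub>0) summable_on K \<and> ?r a \<le> \<rho>" for a \<rho>
    by (simp add: hs_ball_def hs_norm_eq hs_space_iff coeff_sq_commute[of 1 a a\<^sub>0])
  have key: "AE a in \<mu>0. coeff_sq 1 (a - a\<^sub>0) summable_on K \<and>
      (?r a \<le> \<delta> \<longrightarrow> exp (- (3/4) * ?n * \<delta>\<^sup>2) \<le> ?L a) \<and>
      (2 * \<delta> < ?r a \<longrightarrow> ?L a \<le> exp (- ?n * \<delta>\<^sup>2)) \<and> ?L a \<le> exp (?n / 4 * \<delta>\<^sup>2)"
    using AE_pairing_le
  proof eventually_elim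
    fix a
    let ?p = "hs_pairing K lam \<phi> (a - a\<^sub>0) x" and ?X = "hs_norm K lam \<phi> (1 - \<sigma>) x"
    assume a: "coeff_sq 1 (a - a\<^sub>0) summable_on K \<and>
      (\<forall>x. coeff_sq (1 - \<sigma>) x summable_on K \<longrightarrow> \<bar>hs_pairing K lam \<phi> (a - a\<^sub>0) x\<bar>
        \<le> ?r a powr \<theta> * noise_factor * hs_norm K lam \<phi> (1 - \<sigma>) x)"
    then have "sqrt ?n * \<bar>?p\<bar> \<le> sqrt ?n * (?r a powr \<theta> * noise_factor * ?X)"
      using x by (intro mult_left_mono) auto
    \<comment> \<open>The 4 in the noise hypothesis produces the quarter expected by
      \<open>tilted_quadratic_bounds\<close>.\<close>
    also have "\<dots> = sqrt ?n * ?r a powr \<theta> / 4 * (4 * noise_factor * ?X)" by simp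
    also have "\<dots> \<le> sqrt ?n * ?r a powr \<theta> / 4 * (sqrt ?n * \<delta> powr (2 - \<theta>))"
      by (intro mult_left_mono noise) auto
    also have "\<dots> = (sqrt ?n * sqrt ?n) / 4 * (\<delta> powr (2 - \<theta>) * ?r a powr \<theta>)" by (simp add: mult_ac)
    finally have q: "\<bar>sqrt ?n * ?p\<bar> \<le> ?n / 4 * (\<delta> powr (2 - \<theta>) * ?r a powr \<theta>)"
      by (simp add: abs_mult)
    show "coeff_sq 1 (a - a\<^sub>0) summable_on K \<and>
      (?r a \<le> \<delta> \<longrightarrow> exp (- (3/4) * ?n * \<delta>\<^sup>2) \<le> ?L a) \<and>
      (2 * \<delta> < ?r a \<longrightarrow> ?L a \<le> exp (- ?n * \<delta>\<^sup>2)) \<and> ?L a \<le> exp (?n / 4 * \<delta>\<^sup>2)"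
      using a tilted_quadratic_bounds[OF \<theta>_bounds \<delta> _ _ q] unfolding likelihood_def exp_le_cancel_iff by simp
  qed
  have Lpos: "0 < ?L a" for a by (simp add: likelihood_def)
  have intL: "integrable \<mu>0 ?L"
    using key Lpos by (intro prior.integrable_const_bound[of _ "exp (?n / 4 * \<delta>\<^sup>2)"]) (auto simp: less_imp_le)
  have intLi: "integrable \<mu>0 (\<lambda>a. indicator A a * ?L a)" if "A \<in> sets borel" for A
    using integrable_mult_indicator[OF _ intL, of A] that sets_prior by simp
  define Z where "Z = (\<integral>a. ?L a \<partial>\<mu>0)"
  define N where "N = (\<integral>a. indicator (- ?B R) a * ?L a \<partial>\<mu>0)"
  have "exp (- (3/4) * ?n * \<delta>\<^sup>2) * ?m = (\<integral>a. indicator (?B \<delta>) a * exp (- (3/4) * ?n * \<delta>\<^sup>2) \<partial>\<mu>0)"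
    using sets_eq_imp_space_eq[OF sets_prior] by simp
  also have "\<dots> \<le> Z"
    unfolding Z_def
  proof (rule integral_mono_AE)
    show "integrable \<mu>0 (\<lambda>a. indicator (?B \<delta>) a * exp (- (3/4) * ?n * \<delta>\<^sup>2))"
      by (simp add: prior.emeasure_eq_measure)
    show "AE a in \<mu>0. indicator (?B \<delta>) a * exp (- (3/4) * ?n * \<delta>\<^sup>2) \<le> ?L a"
      using key by eventually_elim (use Lpos in \<open>auto simp: indicator_def ball less_imp_le\<close>)
  qed (rule intL)
  finally have Zge: "exp (- (3/4) * ?n * \<delta>\<^sup>2) * ?m \<le> Z" .
  then have Z: "0 < Z" using m by (smt (verit) exp_gt_zero mult_pos_pos)
  have "N \<le> (\<integral>a. exp (- ?n * \<delta>\<^sup>2) \<partial>\<mu>0)"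
    unfolding N_def
  proof (rule integral_mono_AE)
    show "integrable \<mu>0 (\<lambda>a. indicator (- ?B R) a * ?L a)" by (rule intLi) measurable
    show "AE a in \<mu>0. indicator (- ?B R) a * ?L a \<le> exp (- ?n * \<delta>\<^sup>2)"
      \<comment> \<open>A point may lie outside the ball merely by lying outside the space, where
        the norm is 0. The summability part of \<open>key\<close> rules this out, so being outside
        means distance > R, hence > 2 \<delta>.\<close>
      using key by eventually_elim (use R in \<open>auto simp: indicator_def ball\<close>)
  qed simp
  then have Nle: "N \<le> exp (- ?n * \<delta>\<^sup>2)" using prior.prob_space by simp
  have split: "(\<integral>a. indicator (?B R) a * ?L a \<partial>\<mu>0) = Z - N"
  proof -
    have "Z - N = (\<integral>a. ?L a - indicator (- ?B R) a * ?L a \<partial>\<mu>0)"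
      unfolding Z_def N_def by (intro Bochner_Integration.integral_diff[symmetric] intL intLi) measurable
    also have "\<dots> = (\<integral>a. indicator (?B R) a * ?L a \<partial>\<mu>0)"
      by (intro Bochner_Integration.integral_cong) (auto simp: indicator_def)
    finally show ?thesis by simp
  qed
  have Zeq: "(\<integral>\<^sup>+ b. ennreal (?L b) \<partial>\<mu>0) = ennreal Z"
    unfolding Z_def by (intro nn_integral_eq_integral intL) (auto simp: Lpos less_imp_le)
  have "emeasure (posterior K lam \<phi> \<mu>0 a\<^sub>0 n x) (?B R)
      = (\<integral>\<^sup>+a. ennreal (?L a) / ennreal Z * indicator (?B R) a \<partial>\<mu>0)"
    unfolding posterior_def Zeq by (rule emeasure_density) measurable
  also have "\<dots> = (\<integral>\<^sup>+a. ennreal (indicator (?B R) a * ?L a / Z) \<partial>\<mu>0)"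
    using Z Lpos by (intro nn_integral_cong) (auto simp: indicator_def divide_ennreal less_imp_le)
  also have "\<dots> = ennreal (\<integral>a. indicator (?B R) a * ?L a / Z \<partial>\<mu>0)"
    using Z Lpos by (intro nn_integral_eq_integral integrable_divide intLi) (auto simp: less_imp_le)
  also have "\<dots> = ennreal ((Z - N) / Z)" by (simp add: split)
  finally have "emeasure (posterior K lam \<phi> \<mu>0 a\<^sub>0 n x) (?B R) = ennreal ((Z - N) / Z)" .
  moreover have "0 \<le> Z - N"
    unfolding split[symmetric] by (intro integral_nonneg_AE) (auto simp: Lpos less_imp_le)
  ultimately have "measure (posterior K lam \<phi> \<mu>0 a\<^sub>0 n x) (?B R) = (Z - N) / Z"
    using Z by (simp add: measure_def)
  then have "1 - N / Z \<le> measure (posterior K lam \<phi> \<mu>0 a\<^sub>0 n x) (?B R)"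
    using Z by (simp add: diff_divide_distrib)
  moreover have "N / Z \<le> exp (- (?n * \<delta>\<^sup>2 / 4)) / ?m"
  proof -
    have "N / Z \<le> exp (- ?n * \<delta>\<^sup>2) / (exp (- (3/4) * ?n * \<delta>\<^sup>2) * ?m)"
      using Nle Zge m Z by (intro frac_le) auto
    also have "\<dots> = (exp (- ?n * \<delta>\<^sup>2) / exp (- (3/4) * ?n * \<delta>\<^sup>2)) / ?m" by simp
    also have "\<dots> = exp (- (?n * \<delta>\<^sup>2 / 4)) / ?m" by (simp add: exp_diff[symmetric])
    finally show ?thesis .
  qed
  ultimately show ?thesis by linarith
qed

text \<open>A non-measurable event would have \<open>measure\<close> 0, so the consistency events
  must be shown measurable before their probability can be bounded below by that of a smaller
  event.\<close>

lemma measurable_posterior_measure: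
  assumes B[measurable]: "B \<in> sets borel"
  shows "(\<lambda>\<omega>. measure (posterior K lam \<phi> \<mu>0 a\<^sub>0 n (\<xi> \<omega>)) B) \<in> borel_measurable P"
proof -
  let ?L = "\<lambda>\<omega> a. ennreal (likelihood K lam \<phi> a\<^sub>0 n (\<xi> \<omega>) a)"
  have [measurable]: "(\<lambda>z. snd z) \<in> borel_measurable (P \<Otimes>\<^sub>M \<mu>0)"
    "(\<lambda>z. \<xi> (fst z)) \<in> borel_measurable (P \<Otimes>\<^sub>M \<mu>0)"
    using measurable_snd[of P \<mu>0] measurable_compose[OF measurable_fst noise_measurable]
      measurable_cong_sets[OF refl sets_prior] by auto
  have Lpair[measurable]: "(\<lambda>z. ?L (fst z) (snd z)) \<in> borel_measurable (P \<Otimes>\<^sub>M \<mu>0)"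
    by (rule measurable_compose[OF measurable_likelihood measurable_ennreal]) auto
  have [measurable]: "?L \<omega> \<in> borel_measurable \<mu>0" for \<omega>
    by (rule measurable_compose[OF measurable_likelihood measurable_ennreal])
      (auto simp: measurable_cong_sets[OF sets_prior refl])
  have Z[measurable]: "(\<lambda>\<omega>. \<integral>\<^sup>+b. ?L \<omega> b \<partial>\<mu>0) \<in> borel_measurable P"
    using Lpair by (intro prior.borel_measurable_nn_integral) (simp add: case_prod_beta)
  have "(\<lambda>z. ?L (fst z) (snd z) / (\<integral>\<^sup>+b. ?L (fst z) b \<partial>\<mu>0) * indicator B (snd z)) \<in> borel_measurable (P \<Otimes>\<^sub>M \<mu>0)"
    by (intro borel_measurable_times_ennreal borel_measurable_divide_ennreal Lpair
        measurable_compose[OF measurable_fst Z] borel_measurable_indicator') measurable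
  then have "(\<lambda>\<omega>. \<integral>\<^sup>+a. ?L \<omega> a / (\<integral>\<^sup>+b. ?L \<omega> b \<partial>\<mu>0) * indicator B a \<partial>\<mu>0) \<in> borel_measurable P"
    by (intro prior.borel_measurable_nn_integral) (simp add: case_prod_beta)
  moreover have "emeasure (posterior K lam \<phi> \<mu>0 a\<^sub>0 n (\<xi> \<omega>)) B
      = (\<integral>\<^sup>+a. ?L \<omega> a / (\<integral>\<^sup>+b. ?L \<omega> b \<partial>\<mu>0) * indicator B a \<partial>\<mu>0)" for \<omega>
    unfolding posterior_def by (rule emeasure_density) (use B sets_prior in auto)
  ultimately show ?thesis unfolding measure_def by simp
qed

text \<open>The \<open>noise\<close> limit drives the probability of the good event to 1, the
  \<open>mass\<close> limit drives the guaranteed posterior mass to 1. Keeping R apart from \<delta>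
  covers fixed radii as well as rates.\<close>

theorem posterior_contraction:
  fixes \<delta> R :: "nat \<Rightarrow> real"
  defines "m \<equiv> \<lambda>n. measure \<mu>0 (hs_ball K lam \<phi> 1 a\<^sub>0 (\<delta> n))"
  assumes pos: "\<forall>\<^sub>F n in sequentially. 0 < \<delta> n" "\<forall>\<^sub>F n in sequentially. 0 < m n"
    and R: "\<forall>\<^sub>F n in sequentially. 2 * \<delta> n \<le> R n"
    and noise: "filterlim (\<lambda>n. sqrt (real n) * \<delta> n powr (2 - \<theta>)) at_top sequentially"
    and mass: "filterlim (\<lambda>n. real n * (\<delta> n)\<^sup>2 / 4 + ln (m n)) at_top sequentially"
  shows "\<exists>l :: nat \<Rightarrow> real. l \<longlonglongrightarrow> 1 \<and>
    (\<lambda>n. measure P {\<omega> \<in> space P.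
      measure (posterior K lam \<phi> \<mu>0 a\<^sub>0 n (\<xi> \<omega>)) (hs_ball K lam \<phi> 1 a\<^sub>0 (R n)) \<ge> l n}) \<longlonglongrightarrow> 1"
proof (intro exI conjI)
  \<comment> \<open>Writing \<open>m n\<close> as the exponential of its logarithm turns the error
    into exp of minus the quantity in the \<open>mass\<close> hypothesis.\<close>
  define l where "l n = 1 - exp (- (real n * (\<delta> n)\<^sup>2 / 4)) / m n" for n
  let ?G = "\<lambda>n. {\<omega> \<in> space P.
      measure (posterior K lam \<phi> \<mu>0 a\<^sub>0 n (\<xi> \<omega>)) (hs_ball K lam \<phi> 1 a\<^sub>0 (R n)) \<ge> l n}"
  have "(\<lambda>n. 1 - exp (- (real n * (\<delta> n)\<^sup>2 / 4 + ln (m n)))) \<longlonglongrightarrow> 1 - 0"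
    by (intro tendsto_intros filterlim_compose[OF exp_at_bot]
        filterlim_compose[OF filterlim_uminus_at_bot_at_top mass])
  then have "(\<lambda>n. 1 - exp (- (real n * (\<delta> n)\<^sup>2 / 4 + ln (m n)))) \<longlonglongrightarrow> 1" by simp
  then show "l \<longlonglongrightarrow> 1"
  proof (rule Lim_transform_eventually)
    show "\<forall>\<^sub>F n in sequentially. 1 - exp (- (real n * (\<delta> n)\<^sup>2 / 4 + ln (m n))) = l n"
      using pos(2) by eventually_elim (simp add: l_def exp_diff)
  qed
  \<comment> \<open>The square of the largest noise norm that \<open>posterior_ball_ge\<close>
    tolerates at stage n.\<close>
  define T where "T n = (sqrt (real n) * \<delta> n powr (2 - \<theta>) / (4 * noise_factor))\<^sup>2" for n
  define C where "C = (\<Sum>\<^sub>\<infinity>k\<in>K. lam k powr (2 * \<sigma>))"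
  have T: "filterlim T at_top sequentially"
    unfolding T_def divide_inverse using noise_factor_pos
    by (intro filterlim_pow_at_top filterlim_at_top_mult_tendsto_pos[OF tendsto_const _ noise]) auto
  have G[measurable]: "?G n \<in> sets P" for n
  proof -
    have [measurable]: "(\<lambda>\<omega>. measure (posterior K lam \<phi> \<mu>0 a\<^sub>0 n (\<xi> \<omega>)) (hs_ball K lam \<phi> 1 a\<^sub>0 (R n)))
        \<in> borel_measurable P"
      by (intro measurable_posterior_measure hs_ball_measurable) simp
    show ?thesis by measurable
  qed
  have "\<forall>\<^sub>F n in sequentially. 0 < T n" using T by (simp add: filterlim_at_top_dense)
  then have lower: "\<forall>\<^sub>F n in sequentially. 1 - C / T n \<le> measure P (?G n)"
    using pos R
  proof eventually_elim
    fix n assume Tn: "0 < T n" and \<delta>n: "0 < \<delta> n" and mn: "0 < m n" and Rn: "2 * \<delta> n \<le> R n"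
    obtain E where E: "E \<in> sets P"
      "\<And>\<omega>. \<omega> \<in> E \<Longrightarrow> coeff_sq (1 - \<sigma>) (\<xi> \<omega>) summable_on K"
      "\<And>\<omega>. \<omega> \<in> E \<Longrightarrow> (hs_norm K lam \<phi> (1 - \<sigma>) (\<xi> \<omega>))\<^sup>2 \<le> T n"
      "1 - C / T n \<le> measure P E"
      using noise_norm_tail[OF noise.prob_space_axioms noise_gaussian noise_measurable trace_\<sigma> Tn]
      unfolding C_def by blast
    have "E \<subseteq> ?G n"
    proof
      fix \<omega> assume \<omega>: "\<omega> \<in> E"
      have "hs_norm K lam \<phi> (1 - \<sigma>) (\<xi> \<omega>) \<le> sqrt (real n) * \<delta> n powr (2 - \<theta>) / (4 * noise_factor)"
        using E(3)[OF \<omega>] unfolding T_def by (rule power2_le_imp_le) (simp add: noise_factor_pos less_imp_le)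
      then have "4 * noise_factor * hs_norm K lam \<phi> (1 - \<sigma>) (\<xi> \<omega>) \<le> sqrt (real n) * \<delta> n powr (2 - \<theta>)"
        using noise_factor_pos by (simp add: pos_le_divide_eq mult_ac)
      then have "l n \<le> measure (posterior K lam \<phi> \<mu>0 a\<^sub>0 n (\<xi> \<omega>)) (hs_ball K lam \<phi> 1 a\<^sub>0 (R n))"
        using posterior_ball_ge[OF E(2)[OF \<omega>] \<delta>n Rn] mn unfolding l_def m_def by blast
      then show "\<omega> \<in> ?G n" using \<omega> sets.sets_into_space[OF E(1)] by blast
    qed
    then show "1 - C / T n \<le> measure P (?G n)"
      using E(4) noise.finite_measure_mono[OF _ G] by (meson order_trans)
  qed
  have "(\<lambda>n. 1 - C / T n) \<longlonglongrightarrow> 1 - 0"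
    by (intro tendsto_intros tendsto_divide_0[OF tendsto_const] filterlim_at_top_imp_at_infinity T)
  then show "(\<lambda>n. measure P (?G n)) \<longlonglongrightarrow> 1"
    using tendsto_sandwich[OF lower _ _ tendsto_const[of 1]] by simp
qed

end

section \<open>Powers of n and the choice of the rate\<close>

lemma filterlim_nat_powr_at_top:
  fixes p :: real
  assumes "0 < p"
  shows "filterlim (\<lambda>n. real n powr p) at_top sequentially"
proof -
  have "filterlim (\<lambda>n. exp (p * ln (real n))) at_top sequentially"
    by (intro filterlim_compose[OF exp_at_top] filterlim_tendsto_pos_mult_at_top[OF tendsto_const assms]
        filterlim_compose[OF ln_at_top] filterlim_real_sequentially)
  \<comment> \<open>Equality fails at n = 0, where the left side is 1 and the right side 0.\<close>
  moreover have "\<forall>\<^sub>F n in sequentially. exp (p * ln (real n)) = real n powr p"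
    using eventually_gt_at_top[of 0] by eventually_elim (simp add: powr_def)
  ultimately show ?thesis by (rule filterlim_mono_eventually[OF _ order_refl order_refl])
qed

text \<open>The first power is the gain n * (\<delta> n)^2 / 4, the second the cost of a small prior
  ball. Factoring out n powr q leaves a bracket that tends to infinity.\<close>

lemma filterlim_powr_minus_powr_at_top:
  fixes p q C :: real
  assumes "0 \<le> q" "q < p"
  shows "filterlim (\<lambda>n. real n powr p / 4 - C * real n powr q) at_top sequentially"
proof -
  have pow: "filterlim (\<lambda>n. real n powr (p - q)) at_top sequentially"
    using assms by (intro filterlim_nat_powr_at_top) simp
  have "filterlim (\<lambda>n. (real n powr (p - q) / 4 + (- C))) at_top sequentially"
    unfolding divide_inverse
    by (subst add.commute, intro filterlim_tendsto_add_at_top[OF tendsto_const]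
        filterlim_at_top_mult_tendsto_pos[OF tendsto_const _ pow]) simp
  then show ?thesis
  proof (rule filterlim_at_top_mono)
    have "\<forall>\<^sub>F n in sequentially. C \<le> real n powr (p - q) / 4"
      using \<open>filterlim (\<lambda>n. (real n powr (p - q) / 4 + (- C))) at_top sequentially\<close>
      by (auto simp: filterlim_at_top dest: spec[of _ 0] elim: eventually_mono)
    then show "\<forall>\<^sub>F n in sequentially. real n powr (p - q) / 4 + (- C)
        \<le> real n powr p / 4 - C * real n powr q"
      using eventually_ge_at_top[of 1]
    proof eventually_elim
      fix n :: nat assume n: "C \<le> real n powr (p - q) / 4" "1 \<le> n"
      \<comment> \<open>The bracket is eventually nonnegative and n powr q is at least 1, so the
        factor only helps.\<close>
      have "1 * (real n powr (p - q) / 4 - C) \<le> real n powr q * (real n powr (p - q) / 4 - C)"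
        using n assms by (intro mult_right_mono ge_one_powr_ge_zero) auto
      also have "\<dots> = real n powr p / 4 - C * real n powr q"
        by (simp add: algebra_simps flip: powr_add)
      finally show "real n powr (p - q) / 4 + (- C) \<le> real n powr p / 4 - C * real n powr q" by simp
    qed
  qed
qed

theorem theorem3p3:
  fixes \<Gamma> :: "'h::{real_inner, complete_space} \<Rightarrow> 'h"
    and K :: "nat set" and lam :: "nat \<Rightarrow> real" and \<phi> :: "nat \<Rightarrow> 'h"
    and P :: "'w measure" and \<xi> :: "'w \<Rightarrow> 'h"
    and \<mu>0 :: "'h measure" and a\<^sub>0 :: 'h
    and \<sigma>0 s U :: real
  assumes "covariance_operator \<Gamma> K lam \<phi>"
    and "prob_space P" and "\<xi> \<in> borel_measurable P"
    and "centred_gaussian \<Gamma> (distr P borel \<xi>)"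
    and "prob_space \<mu>0" and "sets \<mu>0 = sets borel"
    and "\<sigma>0 \<ge> 0" and "\<forall>\<sigma>>\<sigma>0. (\<lambda>k. lam k powr (2 * \<sigma>)) summable_on K"
    and "s > 1 + \<sigma>0"
    and "AE a in \<mu>0. a \<in> hs_space K lam \<phi> s \<and> hs_norm K lam \<phi> s a \<le> U"
    and "a\<^sub>0 \<in> hs_support K lam \<phi> 1 \<mu>0"
    and "a\<^sub>0 \<in> hs_space K lam \<phi> s"
  shows "consistent P (\<lambda>n \<omega>. posterior K lam \<phi> \<mu>0 a\<^sub>0 n (\<xi> \<omega>)) (hs_ball K lam \<phi> 1 a\<^sub>0) \<and>
    (\<forall>\<rho>>0. small_ball_bound K lam \<phi> \<mu>0 a\<^sub>0 \<rho> \<longrightarrow>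
      (\<forall>\<kappa>. \<kappa> < min (1 / (2 * (2 - (s - 1 - \<sigma>0) / (s - 1)))) (1 / (2 + \<rho>)) \<longrightarrow>
        consistent_with_rate P (\<lambda>n \<omega>. posterior K lam \<phi> \<mu>0 a\<^sub>0 n (\<xi> \<omega>)) (hs_ball K lam \<phi> 1 a\<^sub>0)
          (\<lambda>n. real n powr (- \<kappa>))))"
proof (intro conjI allI impI)
  interpret prior: prob_space \<mu>0 by fact
  let ?B = "hs_ball K lam \<phi> 1 a\<^sub>0"
  have regression: "bounded_prior_regression \<Gamma> K lam \<phi> P \<mu>0 \<xi> a\<^sub>0 s \<sigma> U"
    if "\<sigma>0 < \<sigma>" "\<sigma> < s - 1" for \<sigma>
    unfolding bounded_prior_regression_def bounded_prior_regression_axioms_def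
    using assms that by auto
  have mass: "0 < measure \<mu>0 (?B r)" if "0 < r" for r
    using assms(11) that by (simp add: hs_support_def prior.emeasure_eq_measure)
  show "consistent P (\<lambda>n \<omega>. posterior K lam \<phi> \<mu>0 a\<^sub>0 n (\<xi> \<omega>)) ?B"
    unfolding consistent_def
  proof (intro allI impI)
    fix \<epsilon> :: real assume \<epsilon>: "0 < \<epsilon>"
    obtain \<sigma> where \<sigma>: "\<sigma>0 < \<sigma>" "\<sigma> < s - 1" using dense[of \<sigma>0 "s - 1"] assms(9) by auto
    interpret bounded_prior_regression \<Gamma> K lam \<phi> P \<mu>0 \<xi> a\<^sub>0 s \<sigma> U by (rule regression[OF \<sigma>])
    have sqrt_top: "filterlim (\<lambda>n. sqrt (real n)) at_top sequentially"
      by (rule filterlim_compose[OF sqrt_at_top filterlim_real_sequentially])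
    \<comment> \<open>A constant inner radius \<epsilon>/2 suffices: the support hypothesis gives
      its ball a positive mass that does not depend on n, and linear growth outweighs a
      constant.\<close>
    have "filterlim (\<lambda>n. sqrt (real n) * (\<epsilon> / 2) powr (2 - \<theta>)) at_top sequentially"
      using \<epsilon> by (intro filterlim_at_top_mult_tendsto_pos[OF tendsto_const _ sqrt_top]) simp
    moreover have "filterlim (\<lambda>n. real n * ((\<epsilon> / 2)\<^sup>2 / 4)) at_top sequentially"
      using \<epsilon> by (intro filterlim_at_top_mult_tendsto_pos[OF tendsto_const _ filterlim_real_sequentially]) simp
    then have "filterlim (\<lambda>n. ln (measure \<mu>0 (?B (\<epsilon> / 2))) + real n * ((\<epsilon> / 2)\<^sup>2 / 4)) at_top sequentially"
      by (rule filterlim_tendsto_add_at_top[OF tendsto_const])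
    then have "filterlim (\<lambda>n. real n * (\<epsilon> / 2)\<^sup>2 / 4 + ln (measure \<mu>0 (?B (\<epsilon> / 2)))) at_top sequentially"
      by (simp add: add.commute)
    ultimately show "\<exists>l :: nat \<Rightarrow> real. l \<longlonglongrightarrow> 1 \<and>
        (\<lambda>n. measure P {\<omega> \<in> space P.
          measure (posterior K lam \<phi> \<mu>0 a\<^sub>0 n (\<xi> \<omega>)) (?B \<epsilon>) \<ge> l n}) \<longlonglongrightarrow> 1"
      using posterior_contraction[of "\<lambda>_. \<epsilon> / 2" "\<lambda>_. \<epsilon>"] \<epsilon> mass by simp
  qed
  fix \<rho> \<kappa> :: real
  assume \<rho>: "0 < \<rho>" and sb: "small_ball_bound K lam \<phi> \<mu>0 a\<^sub>0 \<rho>"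
    and \<kappa>: "\<kappa> < min (1 / (2 * (2 - (s - 1 - \<sigma>0) / (s - 1)))) (1 / (2 + \<rho>))"
  obtain C \<epsilon>0 where C: "0 < C" "0 < \<epsilon>0" and
    ln_ge: "\<And>\<epsilon>. 0 < \<epsilon> \<Longrightarrow> \<epsilon> \<le> \<epsilon>0 \<Longrightarrow> - C * \<epsilon> powr (- \<rho>) \<le> ln (measure \<mu>0 (?B \<epsilon>))"
    using sb unfolding small_ball_bound_def by blast
  let ?lt = "(s - 1 - \<sigma>0) / (s - 1)"
  have s1: "0 < s - 1" using assms by linarith
  have den: "0 < 2 - ?lt" using s1 assms(7) by (simp add: field_simps)
  have "0 < min (1 / (2 * (2 - ?lt))) (1 / (2 + \<rho>))" using den \<rho>
    by (simp only: min_less_iff_conj) (intro conjI divide_pos_pos mult_pos_pos, auto)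
  \<comment> \<open>\<kappa> may be zero or negative, while the inner radii must shrink to enter the
    range of the small-ball bound. A positive exponent above \<kappa> gives a faster rate that
    implies the one claimed.\<close>
  then obtain k where k: "max \<kappa> 0 < k" "k < min (1 / (2 * (2 - ?lt))) (1 / (2 + \<rho>))"
    using dense[of "max \<kappa> 0" "min (1 / (2 * (2 - ?lt))) (1 / (2 + \<rho>))"] \<kappa> by auto
  then have k0: "0 < k" "\<kappa> < k" by auto
  \<comment> \<open>Compares the exponents of n * (\<delta> n)^2 and (\<delta> n) powr (-
    \<rho>).\<close>
  have k\<rho>: "k * \<rho> < 1 - 2 * k" using k \<rho> by (simp add: field_simps)
  have half: "x * y < 1 / 2" if "x < 1 / (2 * y)" "0 < y" for x y :: real
    using that by (simp add: field_simps)
  have "k * (2 - ?lt) < 1 / 2" using half[OF _ den] k by simp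
  moreover have "2 - ?lt = 1 + \<sigma>0 / (s - 1)" using s1 by (simp add: field_simps)
  \<comment> \<open>The strict bound on k, solved for \<open>\<sigma>0\<close>. Strictness leaves an
    interval above \<open>\<sigma>0\<close> from which \<sigma> is taken, and the same computation
    backwards gives the noise condition for \<theta>.\<close>
  ultimately have "\<sigma>0 < (s - 1) * (1 / (2 * k) - 1)" using k0 s1 by (simp add: field_simps)
  then obtain \<sigma> where \<sigma>: "\<sigma>0 < \<sigma>" "\<sigma> < s - 1" "\<sigma> < (s - 1) * (1 / (2 * k) - 1)"
    using dense[of \<sigma>0 "min (s - 1) ((s - 1) * (1 / (2 * k) - 1))"] assms(9) by auto
  interpret bounded_prior_regression \<Gamma> K lam \<phi> P \<mu>0 \<xi> a\<^sub>0 s \<sigma> U by (rule regression[OF \<sigma>(1,2)])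
  have "2 - \<theta> = 1 + \<sigma> / (s - 1)" using s1 by (simp add: \<theta>_def field_simps)
  moreover have "\<sigma> / (s - 1) < 1 / (2 * k) - 1"
    using \<sigma>(3) s1 by (simp only: pos_divide_less_eq) (simp add: mult.commute)
  ultimately have "2 - \<theta> < 1 / (2 * k)" by linarith
  then have k\<theta>: "k * (2 - \<theta>) < 1 / 2" using half[of "2 - \<theta>" k] k0 by (simp only: mult.commute)
  define \<delta> where "\<delta> n = real n powr (- k)" for n
  have \<delta>_pos: "\<forall>\<^sub>F n in sequentially. 0 < \<delta> n"
    using eventually_gt_at_top[of 0] by eventually_elim (simp add: \<delta>_def)
  have "\<delta> \<longlonglongrightarrow> 0"
    unfolding \<delta>_def using k0 by (intro tendsto_neg_powr filterlim_real_sequentially) simp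
  then have \<delta>_small: "\<forall>\<^sub>F n in sequentially. \<delta> n < \<epsilon>0" using C(2) by (rule order_tendstoD)
  have noise: "filterlim (\<lambda>n. sqrt (real n) * \<delta> n powr (2 - \<theta>)) at_top sequentially"
  proof -
    have "sqrt (real n) * \<delta> n powr (2 - \<theta>) = real n powr (1 / 2 - k * (2 - \<theta>))" for n
      by (simp add: \<delta>_def powr_half_sqrt[symmetric] powr_powr flip: powr_add)
    then show ?thesis
      using k\<theta> by (simp only:) (intro filterlim_nat_powr_at_top, simp)
  qed
  have "filterlim (\<lambda>n. real n powr (1 - 2 * k) / 4 - C * real n powr (k * \<rho>)) at_top sequentially"
    using k0 \<rho> k\<rho> by (intro filterlim_powr_minus_powr_at_top) auto
  then have small_ball: "filterlim (\<lambda>n. real n * (\<delta> n)\<^sup>2 / 4 + ln (measure \<mu>0 (?B (\<delta> n)))) at_top sequentially"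
  proof (rule filterlim_at_top_mono)
    show "\<forall>\<^sub>F n in sequentially. real n powr (1 - 2 * k) / 4 - C * real n powr (k * \<rho>)
        \<le> real n * (\<delta> n)\<^sup>2 / 4 + ln (measure \<mu>0 (?B (\<delta> n)))"
      using eventually_gt_at_top[of 0] \<delta>_pos \<delta>_small
    proof eventually_elim
      fix n :: nat assume n: "0 < n" "0 < \<delta> n" "\<delta> n < \<epsilon>0"
      have "real n * (\<delta> n)\<^sup>2 = real n powr 1 * real n powr (- 2 * k)"
        using n by (simp add: \<delta>_def powr_power mult.commute)
      also have "\<dots> = real n powr (1 - 2 * k)" by (simp only: powr_add[symmetric]) simp
      finally have "real n * (\<delta> n)\<^sup>2 = real n powr (1 - 2 * k)" .
      moreover have "\<delta> n powr (- \<rho>) = real n powr (k * \<rho>)" by (simp add: \<delta>_def powr_powr)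
      ultimately show "real n powr (1 - 2 * k) / 4 - C * real n powr (k * \<rho>)
        \<le> real n * (\<delta> n)\<^sup>2 / 4 + ln (measure \<mu>0 (?B (\<delta> n)))"
        using ln_ge[of "\<delta> n"] n by simp
    qed
  qed
  have mass_pos: "\<forall>\<^sub>F n in sequentially. 0 < measure \<mu>0 (?B (\<delta> n))"
    using \<delta>_pos by eventually_elim (rule mass)
  \<comment> \<open>The outer radius uses the slower rate \<kappa>, which is where the final
    constant M = 2 comes from.\<close>
  have "\<forall>\<^sub>F n in sequentially. 2 * \<delta> n \<le> 2 * real n powr (- \<kappa>)"
    using eventually_ge_at_top[of 1] by eventually_elim (use k0 in \<open>simp add: \<delta>_def powr_mono\<close>)
  from posterior_contraction[OF \<delta>_pos mass_pos this noise small_ball]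
  show "consistent_with_rate P (\<lambda>n \<omega>. posterior K lam \<phi> \<mu>0 a\<^sub>0 n (\<xi> \<omega>)) ?B (\<lambda>n. real n powr (- \<kappa>))"
    unfolding consistent_with_rate_def by (intro exI[of _ 2]) simp
qed

end
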